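(* Let $\Phi$, $\xi$, $\sigma$, $F$, $S$ satisfy Assumptions (A1)–(A5) listed in the context. If $(u,\nu)$ is the entropy solution of the obstacle problem $\Pi_S(\Phi,F,\xi)$, then $u\ge0$ almost everywhere in $Q_T$, almost surely.
   Context: Setting. Fix $T>0$, $d\ge1$, $m>1$, $\kappa\in(0,1/2]$, $\bar\kappa\in(0,1)$, $K\ge1$, $N_0\ge0$. $\mathbb{T}^d$ is the $d$-dimensional torus and $Q_T=[0,T]\times\mathbb{T}^d$. $(\Omega,\mathcal F,\{\mathcal F_t\},\mathbb P)$ is a complete filtered probability space, $\{W^k\}_{k\ge1}$ are independent $\{\mathcal F_t\}$-Wiener processes, and $\Omega_T=\Omega\times[0,T]$. For $g:\mathbb R\to\mathbb R$ put $\llbracket g\rrbracket(r)=\int_0^r g(s)\,ds$. $\mathcal E$ is the set of convex $\eta\in C^2(\mathbb R)$ with $\eta''$ compactly supported. Assumptions. (A1) $\Phi:\mathbb R\to\mathbb R$ is differentiable, strictly increasing and odd; $\zeta(r):=\sqrt{\Phi'(r)}$ is differentiable away from the origin, $|\zeta(0)|\le K$, $|\zeta'(r)|\le K|r|^{\frac{m-3}{2}}$ for all $r\in(0,\infty)$, $K\zeta(r)\ge\mathbf 1_{\{|r|\ge1\}}$, and $K|\llbracket\zeta\rrbracket(r)-\llbracket\zeta\rrbracket(s)|\ge|r-s|$ if $|r|\vee|s|\ge1$, $\ge|r-s|^{\frac{m+1}{2}}$ if $|r|\vee|s|<1$. (A2) $\xi\ge0$ is an $\mathcal F_0$-measurable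 $L_{m+1}(\mathbb T^d)$-valued random variable with $\mathbb E\|\xi\|_{L_{m+1}(\mathbb T^d)}^{m+1}<\infty$. (A3) $\sigma=(\sigma^k)_{k\ge1}:\mathbb R\to l_2$ satisfies $\sigma(0)=0$ and $|\sigma(r)-\sigma(s)|_{l_2}\le K(|r-s|^{1/2+\kappa}+|r-s|)$ for all $r,s\in\mathbb R$. (A4) $F:Q_T\times\mathbb R\to\mathbb R$ is (Borel measurable and) such that $F(t,x,0)=0$ and $|F(t,x_1,r_1)-F(t,x_2,r_2)|\le K|x_1-x_2|^{\bar\kappa}+N_0|r_1-r_2|$. (A5) The obstacle $S=S(\omega,t)$ (independent of $x$, continuous adapted) satisfies $dS=h_S\,dt+\sum_{k}\sigma^k(S)\,dW^k_t$ on $[0,T]$, $S(0)=S_0$, with $h_S\in L_2(\Omega_T)$ predictable and $S_0\in L_2(\Omega)$ $\mathcal F_0$-measurable; $S(t)\ge0$ for all $t\in[0,T]$; and $S_0\ge\xi(x)$ for all $(\omega,x)\in\Omega\times\mathbb T^d$. Obstacle problem $\Pi_S(\Phi,F,\xi)$ (formal form): $du=[\Delta\Phi(u)+F(t,x,u)]dt-\nu\,dt+\sum_k\sigma^k(u)dW^k_t$, $u(0)=\xi$, $u\le S$, $\int_{Q_T}(u-S)\nu\,dt\,dx=0$. Entropy solution of $\Pi_S(\Phi,F,\xi)$: a pair $(u,\nu)$ such that (i) $u,\nu$ are predictable, $u\in L_{m+1}(\Omega_T;L_{m+1}(\mathbb T^d))$, $\nu\in L_2(\Omega_T;L_2(\mathbb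 T^d))$, $\nu\ge0$; (ii) for all $f\in C_b(\mathbb R)$: $\llbracket\zeta f\rrbracket(u)\in L_2(\Omega_T;H^1(\mathbb T^d))$ and $\partial_{x_i}\llbracket\zeta f\rrbracket(u)=f(u)\,\partial_{x_i}\llbracket\zeta\rrbracket(u)$; (iii) for all $(\eta,\varphi,\varrho)\in\mathcal E\times C_c^\infty([0,T))\times C^\infty(\mathbb T^d)$ with $\phi:=\varphi\varrho\ge0$, almost surely $$-\int_{Q_T}\eta(u)\partial_t\phi\,dxdt\le\int_{\mathbb T^d}\eta(\xi)\phi(0)dx+\int_{Q_T}\llbracket\zeta^2\eta'\rrbracket(u)\Delta\phi\,dxdt+\int_{Q_T}\eta'(u)(F(t,x,u)-\nu)\phi\,dxdt$$ $$+\int_{Q_T}\Big(\tfrac12\eta''(u)\sum_k|\sigma^k(u)|^2\phi-\eta''(u)|\nabla\llbracket\zeta\rrbracket(u)|^2\phi\Big)dxdt+\sum_k\int_0^T\!\!\int_{\mathbb T^d}\eta'(u)\phi\,\sigma^k(u)\,dx\,dW^k_t;$$ (iv) $u\le S$ almost everywhere in $Q_T$, almost surely, and $\int_{Q_T}(u-S)\nu\,dtdx=0$ a.s. *)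

theory Defs
  imports "HOL-Probability.Probability"
begin

section \<open>Function spaces on the torus\<close>

text \<open>
  A function on the torus $R^d / Z^d$ is a function on $R^d$ that has period 1 in every
  coordinate. For periodic functions, Hoelder continuity in the Euclidean norm is the same as
  Hoelder continuity in the quotient metric. Integration takes place over the fundamental cube.
\<close>

definition periodic :: "(real^'n \<Rightarrow> 'b) \<Rightarrow> bool" where
  "periodic f \<longleftrightarrow> (\<forall>x i. f (x + axis i 1) = f x)"

definition torus :: "(real^'n) measure" where
  "torus = restrict_space lborel {x. \<forall>i. 0 \<le> x $ i \<and> x $ i < 1}"

definition interval_measure_to :: "real \<Rightarrow> real measure" where
  "interval_measure_to T = restrict_space lborel {0..T}"

definition QT :: "real \<Rightarrow> (real \<times> (real^'n)) measure" where
  "QT T = interval_measure_to T \<Otimes>\<^sub>M torus"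

definition partial :: "'n \<Rightarrow> (real^'n \<Rightarrow> real) \<Rightarrow> real^'n \<Rightarrow> real" where
  "partial i f x = deriv (\<lambda>s. f (x + s *\<^sub>R axis i 1)) 0"

definition laplacian :: "(real^'n \<Rightarrow> real) \<Rightarrow> real^'n \<Rightarrow> real" where
  "laplacian f x = (\<Sum>i\<in>UNIV. partial i (partial i f) x)"

text \<open>All iterated partial derivatives are (Frechet) differentiable, hence continuous.\<close>

definition smooth_torus :: "(real^'n \<Rightarrow> real) \<Rightarrow> bool" where
  "smooth_torus f \<longleftrightarrow> periodic f \<and> (\<forall>is x. foldr partial is f differentiable (at x))"

text \<open>
  $C_c^\infty([0,T))$: an element need not vanish at 0. It is represented by a smooth
  extension to the whole line; only the values on $[0,T)$ are ever used.
\<close>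

definition time_test :: "real \<Rightarrow> (real \<Rightarrow> real) \<Rightarrow> bool" where
  "time_test T f \<longleftrightarrow> (\<forall>n x. (deriv ^^ n) f differentiable (at x)) \<and> (\<exists>T'<T. \<forall>t\<ge>T'. f t = 0)"

definition Cb :: "(real \<Rightarrow> real) set" where
  "Cb = {f. continuous_on UNIV f \<and> bounded (range f)}"

definition entropies :: "(real \<Rightarrow> real) set" where
  "entropies = {\<eta>. convex_on UNIV \<eta>
     \<and> (\<forall>r. \<eta> differentiable (at r)) \<and> (\<forall>r. deriv \<eta> differentiable (at r))
     \<and> continuous_on UNIV (deriv (deriv \<eta>))
     \<and> compact (closure {r. deriv (deriv \<eta>) r \<noteq> 0})}"

definition primitive :: "(real \<Rightarrow> real) \<Rightarrow> real \<Rightarrow> real" where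
  "primitive g r = (LBINT s=0..r. g s)"


section \<open>Filtered probability spaces and Wiener processes\<close>

text \<open>
  Filtrations are indexed by all reals so that the library notions apply; the values at times
  outside $[0,T]$ play no role, as one can take \<open>Fil t = Fil 0\<close> for negative \<open>t\<close> and
  \<open>Fil t = Fil T\<close> for \<open>t > T\<close>. Processes have type \<open>'a \<Rightarrow> real \<Rightarrow> _\<close>,
  the first argument being the random element.
\<close>

definition complete_filtered_prob_space :: "'a measure \<Rightarrow> (real \<Rightarrow> 'a measure) \<Rightarrow> bool" where
  "complete_filtered_prob_space M Fil \<longleftrightarrow>
     prob_space M \<and> complete_measure M \<and> filtration (space M) Fil
     \<and> (\<forall>t. sets (Fil t) \<subseteq> sets M) \<and> null_sets M \<subseteq> sets (Fil 0)"

definition wiener_process ::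
    "'a measure \<Rightarrow> (real \<Rightarrow> 'a measure) \<Rightarrow> real \<Rightarrow> ('a \<Rightarrow> real \<Rightarrow> real) \<Rightarrow> bool" where
  "wiener_process M Fil T B \<longleftrightarrow>
     (\<forall>t\<in>{0..T}. (\<lambda>\<omega>. B \<omega> t) \<in> borel_measurable (Fil t))
     \<and> (AE \<omega> in M. B \<omega> 0 = 0 \<and> continuous_on {0..T} (B \<omega>))
     \<and> (\<forall>s t. 0 \<le> s \<and> s < t \<and> t \<le> T \<longrightarrow>
          distributed M lborel (\<lambda>\<omega>. B \<omega> t - B \<omega> s) (normal_density 0 (sqrt (t - s)))
          \<and> prob_space.indep_set M (sets (Fil s))
              (sets (vimage_algebra (space M) (\<lambda>\<omega>. B \<omega> t - B \<omega> s) borel)))"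

definition independent_wiener_processes ::
    "'a measure \<Rightarrow> (real \<Rightarrow> 'a measure) \<Rightarrow> real \<Rightarrow> (nat \<Rightarrow> 'a \<Rightarrow> real \<Rightarrow> real) \<Rightarrow> bool" where
  "independent_wiener_processes M Fil T W \<longleftrightarrow>
     (\<forall>k. wiener_process M Fil T (W k))
     \<and> prob_space.indep_vars M (\<lambda>_. Pi\<^sub>M {0..T} (\<lambda>_. borel)) (\<lambda>k \<omega>. restrict (W k \<omega>) {0..T}) UNIV"

text \<open>The predictable sigma-algebra on $\Omega \times [0,T]$.\<close>

definition predictable :: "'a measure \<Rightarrow> (real \<Rightarrow> 'a measure) \<Rightarrow> real \<Rightarrow> ('a \<times> real) measure" where
  "predictable M Fil T = sigma (space M \<times> {0..T})
     ({A \<times> {0} | A. A \<in> sets (Fil 0)}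
      \<union> {A \<times> {s<..t} | A s t. 0 \<le> s \<and> s < t \<and> t \<le> T \<and> A \<in> sets (Fil s)})"

text \<open>
  A predictable process with values in a separable Lebesgue space over the torus is represented
  by a jointly measurable function of $(\omega,t)$ and $x$.
\<close>

definition predictable_field ::
    "'a measure \<Rightarrow> (real \<Rightarrow> 'a measure) \<Rightarrow> real \<Rightarrow> ('a \<Rightarrow> real \<Rightarrow> real^'n \<Rightarrow> 'b::topological_space) \<Rightarrow> bool" where
  "predictable_field M Fil T v \<longleftrightarrow>
     (\<lambda>((\<omega>, t), x). v \<omega> t x) \<in> borel_measurable (predictable M Fil T \<Otimes>\<^sub>M borel)
     \<and> (\<forall>\<omega>\<in>space M. \<forall>t\<in>{0..T}. periodic (v \<omega> t))"

text \<open>Membership in $L_p(\Omega_T; L_p)$ over the torus, in the predictable sense.\<close>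

definition Lp_field ::
    "'a measure \<Rightarrow> (real \<Rightarrow> 'a measure) \<Rightarrow> real \<Rightarrow> real \<Rightarrow> ('a \<Rightarrow> real \<Rightarrow> real^'n \<Rightarrow> 'b::real_normed_vector) \<Rightarrow> bool" where
  "Lp_field M Fil T p v \<longleftrightarrow> predictable_field M Fil T v
     \<and> (\<integral>\<^sup>+\<omega>. (\<integral>\<^sup>+(t, x). ennreal (norm (v \<omega> t x) powr p) \<partial>QT T) \<partial>M) < \<infinity>"

text \<open>
  \<open>v\<close> lies in $L_2(\Omega_T; H^1)$ over the torus and \<open>G\<close> is its weak spatial gradient.
\<close>

definition has_H1_gradient ::
    "'a measure \<Rightarrow> (real \<Rightarrow> 'a measure) \<Rightarrow> real
     \<Rightarrow> ('a \<Rightarrow> real \<Rightarrow> real^'n \<Rightarrow> real) \<Rightarrow> ('a \<Rightarrow> real \<Rightarrow> real^'n \<Rightarrow> real^'n) \<Rightarrow> bool" where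
  "has_H1_gradient M Fil T v G \<longleftrightarrow>
     Lp_field M Fil T 2 v \<and> Lp_field M Fil T 2 G
     \<and> (AE (\<omega>, t) in M \<Otimes>\<^sub>M interval_measure_to T. \<forall>i \<rho>. smooth_torus \<rho> \<longrightarrow>
          (\<integral>x. v \<omega> t x * partial i \<rho> x \<partial>torus) = - (\<integral>x. G \<omega> t x $ i * \<rho> x \<partial>torus))"


section \<open>The Ito integral\<close>

text \<open>
  Elementary integrands
  $\sum_{i<n} c_i 1_{(p_i,p_{i+1}]}$ on $[0,t]$ with $c_i$ bounded and measurable at time $p_i$.
\<close>

definition elementary ::
    "(real \<Rightarrow> 'a measure) \<Rightarrow> 'a set \<Rightarrow> real \<Rightarrow> nat \<Rightarrow> (nat \<Rightarrow> real) \<Rightarrow> (nat \<Rightarrow> 'a \<Rightarrow> real) \<Rightarrow> bool" where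
  "elementary Fil \<Omega> t n p c \<longleftrightarrow>
     0 \<le> p 0 \<and> (\<forall>i<n. p i \<le> p (Suc i)) \<and> p n \<le> t
     \<and> (\<forall>i<n. c i \<in> borel_measurable (Fil (p i)) \<and> bounded (c i ` \<Omega>))"

definition elementary_process ::
    "nat \<Rightarrow> (nat \<Rightarrow> real) \<Rightarrow> (nat \<Rightarrow> 'a \<Rightarrow> real) \<Rightarrow> 'a \<Rightarrow> real \<Rightarrow> real" where
  "elementary_process n p c \<omega> s = (\<Sum>i<n. c i \<omega> * indicator {p i<..p (Suc i)} s)"

definition elementary_integral ::
    "('a \<Rightarrow> real \<Rightarrow> real) \<Rightarrow> nat \<Rightarrow> (nat \<Rightarrow> real) \<Rightarrow> (nat \<Rightarrow> 'a \<Rightarrow> real) \<Rightarrow> 'a \<Rightarrow> real" where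
  "elementary_integral B n p c \<omega> = (\<Sum>i<n. c i \<omega> * (B \<omega> (p (Suc i)) - B \<omega> (p i)))"

text \<open>
  $X = \int_0^t g\,dB$ for predictable $g \in L_2(\Omega \times [0,t])$: the $L_2(\Omega)$-limit of
  the integrals of elementary processes converging to $g$ in $L_2(\Omega \times [0,t])$.
\<close>

definition has_ito_integral ::
    "'a measure \<Rightarrow> (real \<Rightarrow> 'a measure) \<Rightarrow> ('a \<Rightarrow> real \<Rightarrow> real) \<Rightarrow> real
     \<Rightarrow> ('a \<Rightarrow> real \<Rightarrow> real) \<Rightarrow> ('a \<Rightarrow> real) \<Rightarrow> bool" where
  "has_ito_integral M Fil B t g X \<longleftrightarrow>
     (\<lambda>(\<omega>, s). g \<omega> s) \<in> borel_measurable (predictable M Fil t)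
     \<and> X \<in> borel_measurable M
     \<and> (\<exists>n p c. (\<forall>j. elementary Fil (space M) t (n j) (p j) (c j))
         \<and> (\<lambda>j. \<integral>\<^sup>+\<omega>. (\<integral>\<^sup>+s. ennreal ((elementary_process (n j) (p j) (c j) \<omega> s - g \<omega> s)\<^sup>2)
                \<partial>interval_measure_to t) \<partial>M) \<longlonglongrightarrow> 0
         \<and> (\<lambda>j. \<integral>\<^sup>+\<omega>. ennreal ((elementary_integral B (n j) (p j) (c j) \<omega> - X \<omega>)\<^sup>2) \<partial>M) \<longlonglongrightarrow> 0)"

text \<open>$X = \sum_k \int_0^t g^k\,dW^k$, the series converging in $L_2(\Omega)$.\<close>

definition has_ito_series ::
    "'a measure \<Rightarrow> (real \<Rightarrow> 'a measure) \<Rightarrow> (nat \<Rightarrow> 'a \<Rightarrow> real \<Rightarrow> real) \<Rightarrow> real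
     \<Rightarrow> (nat \<Rightarrow> 'a \<Rightarrow> real \<Rightarrow> real) \<Rightarrow> ('a \<Rightarrow> real) \<Rightarrow> bool" where
  "has_ito_series M Fil W t g X \<longleftrightarrow>
     X \<in> borel_measurable M
     \<and> (\<exists>Y. (\<forall>k. has_ito_integral M Fil (W k) t (g k) (Y k))
         \<and> (\<lambda>n. \<integral>\<^sup>+\<omega>. ennreal (((\<Sum>k<n. Y k \<omega>) - X \<omega>)\<^sup>2) \<partial>M) \<longlonglongrightarrow> 0)"

text \<open>
  Extension by localization to integrands whose square is integrable over $[0,t]$ only almost
  surely. It is needed for the obstacle, for whose path no moment bound is assumed.
\<close>

definition has_local_ito_series ::
    "'a measure \<Rightarrow> (real \<Rightarrow> 'a measure) \<Rightarrow> (nat \<Rightarrow> 'a \<Rightarrow> real \<Rightarrow> real) \<Rightarrow> real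
     \<Rightarrow> (nat \<Rightarrow> 'a \<Rightarrow> real \<Rightarrow> real) \<Rightarrow> ('a \<Rightarrow> real) \<Rightarrow> bool" where
  "has_local_ito_series M Fil W t g X \<longleftrightarrow>
     X \<in> borel_measurable M
     \<and> (\<exists>\<tau> Y. (\<forall>n. stopping_time Fil (\<tau> n)) \<and> (\<forall>\<omega>\<in>space M. incseq (\<lambda>n. \<tau> n \<omega>))
         \<and> (AE \<omega> in M. \<forall>\<^sub>F n in sequentially. t \<le> \<tau> n \<omega>)
         \<and> (\<forall>n. has_ito_series M Fil W t (\<lambda>k \<omega> s. if s \<le> \<tau> n \<omega> then g k \<omega> s else 0) (Y n))
         \<and> (\<forall>n. AE \<omega> in M. t \<le> \<tau> n \<omega> \<longrightarrow> X \<omega> = Y n \<omega>))"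


section \<open>Assumptions on the data\<close>

definition zeta :: "(real \<Rightarrow> real) \<Rightarrow> real \<Rightarrow> real" where
  "zeta \<Phi> r = sqrt (deriv \<Phi> r)"

definition diffusion_assms :: "real \<Rightarrow> real \<Rightarrow> (real \<Rightarrow> real) \<Rightarrow> bool" where
  "diffusion_assms m K \<Phi> \<longleftrightarrow>
     (\<forall>r. \<Phi> differentiable (at r)) \<and> strict_mono \<Phi> \<and> (\<forall>r. \<Phi> (- r) = - \<Phi> r)
     \<and> (\<forall>r. r \<noteq> 0 \<longrightarrow> zeta \<Phi> differentiable (at r))
     \<and> \<bar>zeta \<Phi> 0\<bar> \<le> K
     \<and> (\<forall>r>0. \<bar>deriv (zeta \<Phi>) r\<bar> \<le> K * \<bar>r\<bar> powr ((m - 3) / 2))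
     \<and> (\<forall>r. K * zeta \<Phi> r \<ge> indicator {r. \<bar>r\<bar> \<ge> 1} r)
     \<and> (\<forall>r s. K * \<bar>primitive (zeta \<Phi>) r - primitive (zeta \<Phi>) s\<bar>
           \<ge> (if max \<bar>r\<bar> \<bar>s\<bar> \<ge> 1 then \<bar>r - s\<bar> else \<bar>r - s\<bar> powr ((m + 1) / 2)))"

definition initial_assms ::
    "'a measure \<Rightarrow> (real \<Rightarrow> 'a measure) \<Rightarrow> real \<Rightarrow> ('a \<Rightarrow> real^'n \<Rightarrow> real) \<Rightarrow> bool" where
  "initial_assms M Fil m \<xi> \<longleftrightarrow>
     (\<lambda>(\<omega>, x). \<xi> \<omega> x) \<in> borel_measurable (Fil 0 \<Otimes>\<^sub>M borel)
     \<and> (\<forall>\<omega>\<in>space M. periodic (\<xi> \<omega>) \<and> (AE x in torus. 0 \<le> \<xi> \<omega> x)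
           \<and> integrable torus (\<lambda>x. \<bar>\<xi> \<omega> x\<bar> powr (m + 1)))
     \<and> (\<integral>\<^sup>+\<omega>. (\<integral>\<^sup>+x. ennreal (\<bar>\<xi> \<omega> x\<bar> powr (m + 1)) \<partial>torus) \<partial>M) < \<infinity>"

definition noise_assms :: "real \<Rightarrow> real \<Rightarrow> (nat \<Rightarrow> real \<Rightarrow> real) \<Rightarrow> bool" where
  "noise_assms \<kappa> K \<sigma> \<longleftrightarrow>
     (\<forall>r. summable (\<lambda>k. (\<sigma> k r)\<^sup>2)) \<and> (\<forall>k. \<sigma> k 0 = 0)
     \<and> (\<forall>r s. sqrt (\<Sum>k. (\<sigma> k r - \<sigma> k s)\<^sup>2) \<le> K * (\<bar>r - s\<bar> powr (1/2 + \<kappa>) + \<bar>r - s\<bar>))"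

definition source_assms ::
    "real \<Rightarrow> real \<Rightarrow> real \<Rightarrow> real \<Rightarrow> (real \<Rightarrow> real^'n \<Rightarrow> real \<Rightarrow> real) \<Rightarrow> bool" where
  "source_assms T \<kappa>' K N0 F \<longleftrightarrow>
     (\<lambda>(t, x, r). F t x r) \<in> borel_measurable (restrict_space borel ({0..T} \<times> UNIV))
     \<and> (\<forall>t\<in>{0..T}. periodic (F t) \<and> (\<forall>x. F t x 0 = 0)
         \<and> (\<forall>x1 x2 r1 r2. \<bar>F t x1 r1 - F t x2 r2\<bar> \<le> K * norm (x1 - x2) powr \<kappa>' + N0 * \<bar>r1 - r2\<bar>))"

definition obstacle_assms ::
    "'a measure \<Rightarrow> (real \<Rightarrow> 'a measure) \<Rightarrow> (nat \<Rightarrow> 'a \<Rightarrow> real \<Rightarrow> real) \<Rightarrow> real \<Rightarrow> (nat \<Rightarrow> real \<Rightarrow> real)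
     \<Rightarrow> ('a \<Rightarrow> real^'n \<Rightarrow> real) \<Rightarrow> ('a \<Rightarrow> real \<Rightarrow> real) \<Rightarrow> ('a \<Rightarrow> real \<Rightarrow> real) \<Rightarrow> bool" where
  "obstacle_assms M Fil W T \<sigma> \<xi> h S \<longleftrightarrow>
     (\<forall>t\<in>{0..T}. (\<lambda>\<omega>. S \<omega> t) \<in> borel_measurable (Fil t))
     \<and> (\<forall>\<omega>\<in>space M. continuous_on {0..T} (S \<omega>))
     \<and> (\<lambda>(\<omega>, t). h \<omega> t) \<in> borel_measurable (predictable M Fil T)
     \<and> (\<integral>\<^sup>+\<omega>. (\<integral>\<^sup>+t. ennreal ((h \<omega> t)\<^sup>2) \<partial>interval_measure_to T) \<partial>M) < \<infinity>
     \<and> (\<integral>\<^sup>+\<omega>. ennreal ((S \<omega> 0)\<^sup>2) \<partial>M) < \<infinity>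
     \<and> (\<forall>t\<in>{0..T}. \<exists>X. has_local_ito_series M Fil W t (\<lambda>k \<omega> s. \<sigma> k (S \<omega> s)) X
          \<and> (AE \<omega> in M. S \<omega> t = S \<omega> 0 + (\<integral>s. h \<omega> s \<partial>interval_measure_to t) + X \<omega>))
     \<and> (AE \<omega> in M. \<forall>t\<in>{0..T}. 0 \<le> S \<omega> t)
     \<and> (\<forall>\<omega>\<in>space M. \<forall>x. \<xi> \<omega> x \<le> S \<omega> 0)"


section \<open>Entropy solutions of the obstacle problem\<close>

text \<open>
  The field \<open>G\<close> is the weak gradient of \<open>primitive (zeta \<Phi>) (u)\<close>, unique up to null
  sets. The stochastic integral enters through the random variable \<open>X\<close>, likewise unique up to
  null sets.
\<close>

definition entropy_inequality ::
    "'a measure \<Rightarrow> (real \<Rightarrow> 'a measure) \<Rightarrow> (nat \<Rightarrow> 'a \<Rightarrow> real \<Rightarrow> real) \<Rightarrow> real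
     \<Rightarrow> (real \<Rightarrow> real) \<Rightarrow> (nat \<Rightarrow> real \<Rightarrow> real) \<Rightarrow> (real \<Rightarrow> real^'n \<Rightarrow> real \<Rightarrow> real) \<Rightarrow> ('a \<Rightarrow> real^'n \<Rightarrow> real)
     \<Rightarrow> ('a \<Rightarrow> real \<Rightarrow> real^'n \<Rightarrow> real) \<Rightarrow> ('a \<Rightarrow> real \<Rightarrow> real^'n \<Rightarrow> real)
     \<Rightarrow> ('a \<Rightarrow> real \<Rightarrow> real^'n \<Rightarrow> real^'n)
     \<Rightarrow> (real \<Rightarrow> real) \<Rightarrow> (real \<Rightarrow> real) \<Rightarrow> (real^'n \<Rightarrow> real) \<Rightarrow> bool" where
  "entropy_inequality M Fil W T \<Phi> \<sigma> F \<xi> u \<nu> G \<eta> \<phi> \<rho> \<longleftrightarrow>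
     (\<exists>X. has_ito_series M Fil W T
            (\<lambda>k \<omega> t. \<integral>x. deriv \<eta> (u \<omega> t x) * (\<phi> t * \<rho> x) * \<sigma> k (u \<omega> t x) \<partial>torus) X
        \<and> (AE \<omega> in M.
            - (\<integral>(t, x). \<eta> (u \<omega> t x) * (deriv \<phi> t * \<rho> x) \<partial>QT T)
            \<le> (\<integral>x. \<eta> (\<xi> \<omega> x) * (\<phi> 0 * \<rho> x) \<partial>torus)
              + (\<integral>(t, x). primitive (\<lambda>r. (zeta \<Phi> r)\<^sup>2 * deriv \<eta> r) (u \<omega> t x)
                    * (\<phi> t * laplacian \<rho> x) \<partial>QT T)
              + (\<integral>(t, x). deriv \<eta> (u \<omega> t x) * (F t x (u \<omega> t x) - \<nu> \<omega> t x) * (\<phi> t * \<rho> x) \<partial>QT T)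
              + (\<integral>(t, x). 1/2 * deriv (deriv \<eta>) (u \<omega> t x) * (\<Sum>k. (\<sigma> k (u \<omega> t x))\<^sup>2) * (\<phi> t * \<rho> x)
                    - deriv (deriv \<eta>) (u \<omega> t x) * (norm (G \<omega> t x))\<^sup>2 * (\<phi> t * \<rho> x) \<partial>QT T)
              + X \<omega>))"

definition entropy_solution ::
    "'a measure \<Rightarrow> (real \<Rightarrow> 'a measure) \<Rightarrow> (nat \<Rightarrow> 'a \<Rightarrow> real \<Rightarrow> real) \<Rightarrow> real \<Rightarrow> real
     \<Rightarrow> (real \<Rightarrow> real) \<Rightarrow> (nat \<Rightarrow> real \<Rightarrow> real) \<Rightarrow> (real \<Rightarrow> real^'n \<Rightarrow> real \<Rightarrow> real) \<Rightarrow> ('a \<Rightarrow> real^'n \<Rightarrow> real)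
     \<Rightarrow> ('a \<Rightarrow> real \<Rightarrow> real)
     \<Rightarrow> ('a \<Rightarrow> real \<Rightarrow> real^'n \<Rightarrow> real) \<Rightarrow> ('a \<Rightarrow> real \<Rightarrow> real^'n \<Rightarrow> real) \<Rightarrow> bool" where
  "entropy_solution M Fil W T m \<Phi> \<sigma> F \<xi> S u \<nu> \<longleftrightarrow>
     Lp_field M Fil T (m + 1) u \<and> Lp_field M Fil T 2 \<nu>
     \<and> (AE \<omega> in M. AE (t, x) in QT T. 0 \<le> \<nu> \<omega> t x)
     \<and> (\<exists>G. has_H1_gradient M Fil T (\<lambda>\<omega> t x. primitive (zeta \<Phi>) (u \<omega> t x)) G
         \<and> (\<forall>f\<in>Cb. has_H1_gradient M Fil T (\<lambda>\<omega> t x. primitive (\<lambda>r. zeta \<Phi> r * f r) (u \<omega> t x))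
                                          (\<lambda>\<omega> t x. f (u \<omega> t x) *\<^sub>R G \<omega> t x))
         \<and> (\<forall>\<eta>\<in>entropies. \<forall>\<phi> \<rho>. time_test T \<phi> \<and> smooth_torus \<rho> \<and> (\<forall>t\<in>{0..<T}. \<forall>x. 0 \<le> \<phi> t * \<rho> x)
              \<longrightarrow> entropy_inequality M Fil W T \<Phi> \<sigma> F \<xi> u \<nu> G \<eta> \<phi> \<rho>))
     \<and> (AE \<omega> in M. AE (t, x) in QT T. u \<omega> t x \<le> S \<omega> t)
     \<and> (AE \<omega> in M. (\<integral>(t, x). (u \<omega> t x - S \<omega> t) * \<nu> \<omega> t x \<partial>QT T) = 0)"

end

theory Submission
  imports Defs "HOL-Computational_Algebra.Polynomial"
begin

text \<open>
  The proof tests the entropy inequality with a smooth convex approximation \<open>\<eta>\<close> of the negative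
  part of the solution, with the constant spatial test function 1 and with a decreasing time
  weight \<open>\<phi>\<close>. The diffusion term then drops out, and the remaining terms are harmless for the
  following reasons.

  The initial term vanishes because \<open>\<eta>\<close> is zero on the nonnegative half line. The reflection
  term has the wrong sign where \<open>\<eta>'\<close> is negative, but by the complementarity condition it is
  carried by the set where the solution touches the obstacle, and the obstacle is nonnegative
  (\<open>reflection_vanishes_where_negative\<close>). The source is Lipschitz and vanishes at 0, so it
  contributes at most \<open>N0\<close> times the negative part. The Ito correction lives on a strip of width
  \<open>2 d\<close> below 0, where \<open>\<eta>''\<close> is at most \<open>1 / d\<close> and the squared noise coefficient is of order
  \<open>d powr (1 + 2 * \<kappa>)\<close>, so it tends to 0 with \<open>d\<close> (\<open>ito_correction_small\<close>). The gradient term has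
  a favourable sign, and the stochastic integral has mean zero
  (\<open>ito_series_expectation_zero\<close>).

  There remains a linear inequality of Gronwall type for the expected negative part. It is
  closed by the choice of weight: \<open>\<phi> t = exp (- 1 / (c - t) - N0 * t)\<close> for \<open>t < c\<close>, continued by 0,
  is smooth and satisfies \<open>- \<phi>' = N0 * \<phi> + \<psi>\<close> with \<open>\<psi> > 0\<close> before time \<open>c\<close>
  (\<open>deriv_flat_exp_one\<close>). The source is absorbed by \<open>N0 * \<phi>\<close>, so the expected integral of the
  negative part against \<open>\<psi>\<close> is at most an error that vanishes with \<open>d\<close>
  (\<open>neg_part_vanishes_before\<close>). Hence the solution is nonnegative before any time \<open>c < T\<close>.
\<close>

section \<open>Test functions\<close>

lemma partial_const: "partial i (\<lambda>_. c) = (\<lambda>_. 0)"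
  by (simp add: partial_def fun_eq_iff)

lemma smooth_torus_one: "smooth_torus (\<lambda>_::real^'n. 1)"
proof -
  have "\<exists>c. foldr partial is (\<lambda>_::real^'n. 1) = (\<lambda>_. c)" for "is"
    by (induction "is") (auto simp: partial_const)
  then show ?thesis
    unfolding smooth_torus_def periodic_def by (metis differentiable_const)
qed

lemma laplacian_one: "laplacian (\<lambda>_::real^'n. 1) x = 0"
  by (simp add: laplacian_def partial_const)

text \<open>
  The polynomial weight makes the family of these functions closed under differentiation, which
  gives smoothness at once.
\<close>

definition flat_exp :: "real \<Rightarrow> real \<Rightarrow> real poly \<Rightarrow> real \<Rightarrow> real" where
  "flat_exp a c p t = (if t < c then poly p (1 / (c - t)) * exp (- (1 / (c - t)) - a * t) else 0)"

lemma tendsto_poly_times_exp_minus: "((\<lambda>x::real. poly p x * exp (- x)) \<longlongrightarrow> 0) at_top"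
proof -
  have "((\<lambda>x::real. \<Sum>i\<le>degree p. coeff p i * (x ^ i / exp x)) \<longlongrightarrow> (\<Sum>i\<le>degree p. coeff p i * 0)) at_top"
    by (intro tendsto_intros tendsto_power_div_exp_0)
  then show ?thesis
    by (simp add: poly_altdef sum_distrib_right exp_minus divide_inverse mult.assoc)
qed

lemma flat_exp_tendsto_0_left: "(flat_exp a c p \<longlongrightarrow> 0) (at_left c)"
proof -
  have "filterlim (\<lambda>t. 1 / (c - t)) at_top (at_left c)"
  proof -
    have "((\<lambda>t. c - t) \<longlongrightarrow> c - c) (at_left c)"
      by (intro tendsto_intros)
    moreover have "eventually (\<lambda>t. 0 < c - t) (at_left c)"
      by (simp add: eventually_at_filter)
    ultimately show ?thesis
      using filterlim_inverse_at_top[of "\<lambda>t. c - t" "at_left c"] by (simp add: inverse_eq_divide)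
  qed
  from filterlim_compose[OF tendsto_poly_times_exp_minus this]
  have "((\<lambda>t. poly p (1 / (c - t)) * exp (- (1 / (c - t))) * exp (- a * t)) \<longlongrightarrow> 0 * exp (- a * c)) (at_left c)"
    by (intro tendsto_intros)
  then have "((\<lambda>t. poly p (1 / (c - t)) * exp (- (1 / (c - t))) * exp (- a * t)) \<longlongrightarrow> 0) (at_left c)"
    by simp
  then show ?thesis
  proof (rule Lim_transform_eventually)
    show "eventually (\<lambda>t. poly p (1 / (c - t)) * exp (- (1 / (c - t))) * exp (- a * t) = flat_exp a c p t) (at_left c)"
      unfolding eventually_at_filter
      by (rule always_eventually) (simp add: flat_exp_def mult.assoc flip: exp_add)
  qed
qed

definition flat_exp_step :: "real \<Rightarrow> real poly \<Rightarrow> real poly" where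
  "flat_exp_step a p = pderiv p * [:0, 0, 1:] - p * [:a, 0, 1:]"

lemma flat_exp_has_derivative:
  "(flat_exp a c p has_real_derivative flat_exp a c (flat_exp_step a p) t) (at t)"
proof -
  consider "t < c" | "t = c" | "t > c" by linarith
  then show ?thesis
  proof cases
    case 1
    have "((\<lambda>t. poly p (1 / (c - t)) * exp (- (1 / (c - t)) - a * t))
        has_real_derivative flat_exp a c (flat_exp_step a p) t) (at t)"
      using 1 by (auto intro!: derivative_eq_intros DERIV_chain2[OF poly_DERIV]
          simp: flat_exp_def flat_exp_step_def algebra_simps power2_eq_square)
    then show ?thesis
      by (rule has_field_derivative_transform_within_open[where S = "{..<c}"])
        (use 1 in \<open>auto simp: flat_exp_def\<close>)
  next
    case 3
    have "((\<lambda>_. 0) has_real_derivative flat_exp a c (flat_exp_step a p) t) (at t)"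
      using 3 by (simp add: flat_exp_def)
    then show ?thesis
      by (rule has_field_derivative_transform_within_open[where S = "{c<..}"])
        (use 3 in \<open>auto simp: flat_exp_def\<close>)
  next
    case 2
    \<comment> \<open>The difference quotient from the left belongs to the same family, up to sign.\<close>
    have "((\<lambda>s. - flat_exp a c (p * [:0, 1:]) s) \<longlongrightarrow> - 0) (at_left c)"
      by (intro tendsto_minus flat_exp_tendsto_0_left)
    then have "((\<lambda>s. (flat_exp a c p s - flat_exp a c p c) / (s - c)) \<longlongrightarrow> - 0) (at_left c)"
    proof (rule Lim_transform_eventually)
      show "eventually (\<lambda>s. - flat_exp a c (p * [:0, 1:]) s
          = (flat_exp a c p s - flat_exp a c p c) / (s - c)) (at_left c)"
        unfolding eventually_at_filter
        by (rule always_eventually) (auto simp: flat_exp_def frac_eq_eq minus_divide_right)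
    qed
    moreover have "((\<lambda>s. (flat_exp a c p s - flat_exp a c p c) / (s - c)) \<longlongrightarrow> 0) (at_right c)"
      by (rule Lim_transform_eventually[OF tendsto_const])
        (simp add: eventually_at_filter flat_exp_def)
    ultimately show ?thesis
      unfolding 2 has_field_derivative_iff by (simp add: filterlim_at_split flat_exp_def)
  qed
qed

lemma time_test_flat_exp:
  assumes "c < T"
  shows "time_test T (flat_exp a c p)"
proof -
  have deriv: "deriv (flat_exp a c q) = flat_exp a c (flat_exp_step a q)" for q
    using flat_exp_has_derivative[of a c q] by (auto intro!: DERIV_imp_deriv)
  have "(deriv ^^ n) (flat_exp a c p) = flat_exp a c ((flat_exp_step a ^^ n) p)" for n
    by (induction n) (simp_all add: deriv)
  then have "(deriv ^^ n) (flat_exp a c p) differentiable (at t)" for n t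
    using flat_exp_has_derivative real_differentiable_def by metis
  moreover have "\<forall>t\<ge>c. flat_exp a c p t = 0"
    by (simp add: flat_exp_def)
  ultimately show ?thesis
    using assms unfolding time_test_def by blast
qed

text \<open>
  The weight \<open>flat_exp a c 1\<close> is a strict supersolution of \<open>-\<phi>' = a \<phi>\<close> before time \<open>c\<close>: it decays
  faster than the factor \<open>exp (- a t)\<close> alone, with the surplus \<open>flat_exp a c [:0, 0, 1:]\<close>. Testing
  with it therefore does the work of the Gronwall inequality.
\<close>

lemma deriv_flat_exp_one:
  "deriv (flat_exp a c 1) t = - (a * flat_exp a c 1 t + flat_exp a c [:0, 0, 1:] t)"
proof -
  have "deriv (flat_exp a c 1) t = flat_exp a c (flat_exp_step a 1) t"
    by (rule DERIV_imp_deriv[OF flat_exp_has_derivative])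
  then show ?thesis
    by (simp add: flat_exp_def flat_exp_step_def algebra_simps)
qed

lemma flat_exp_one_bounds:
  assumes "0 \<le> a" "0 \<le> t"
  shows "0 \<le> flat_exp a c 1 t" "flat_exp a c 1 t \<le> 1"
  using assms by (auto simp: flat_exp_def intro: order_trans[of _ 0])

lemma flat_exp_square_bounds:
  assumes "0 \<le> a" "0 \<le> t"
  shows "0 \<le> flat_exp a c [:0, 0, 1:] t" "flat_exp a c [:0, 0, 1:] t \<le> 2"
proof -
  have "z\<^sup>2 * exp (- z - a * t) \<le> 2" if "0 \<le> z" for z :: real
  proof -
    have "z\<^sup>2 \<le> 2 * exp z"
      using exp_lower_Taylor_quadratic[OF that] that by simp
    then have "z\<^sup>2 * exp (- z) \<le> 2"
      by (simp add: exp_minus field_simps)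
    moreover have "z\<^sup>2 * exp (- z - a * t) \<le> z\<^sup>2 * exp (- z)"
      using assms by (intro mult_left_mono) auto
    ultimately show ?thesis by linarith
  qed
  from this[of "1 / (c - t)"] show "flat_exp a c [:0, 0, 1:] t \<le> 2"
    by (auto simp: flat_exp_def power2_eq_square)
  show "0 \<le> flat_exp a c [:0, 0, 1:] t"
    by (auto simp: flat_exp_def)
qed

lemma flat_exp_square_pos: "t < c \<Longrightarrow> 0 < flat_exp a c [:0, 0, 1:] t"
  by (simp add: flat_exp_def)

lemma borel_measurable_flat_exp [measurable]: "flat_exp a c p \<in> borel_measurable borel"
proof -
  have "continuous_on UNIV (flat_exp a c p)"
    using flat_exp_has_derivative by (blast intro: DERIV_isCont continuous_at_imp_continuous_on)
  then show ?thesis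
    by (rule borel_measurable_continuous_onI)
qed

section \<open>Smooth convex approximations of the negative part\<close>

lemma has_derivative_max_0_power:
  "((\<lambda>y::real. max 0 y ^ Suc (Suc n)) has_real_derivative (real n + 2) * max 0 y ^ Suc n) (at y)"
proof -
  consider "y < 0" | "y = 0" | "y > 0" by linarith
  then show ?thesis
  proof cases
    case 1
    have "((\<lambda>_. 0) has_real_derivative (real n + 2) * max 0 y ^ Suc n) (at y)"
      using 1 by simp
    then show ?thesis
      by (rule has_field_derivative_transform_within_open[where S = "{..<0}"]) (use 1 in auto)
  next
    case 3
    have "((\<lambda>y. y ^ Suc (Suc n)) has_real_derivative (real n + 2) * max 0 y ^ Suc n) (at y)"
      using 3 by (auto intro!: derivative_eq_intros simp del: power_Suc)
    then show ?thesis
      by (rule has_field_derivative_transform_within_open[where S = "{0<..}"]) (use 3 in auto)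
  next
    case 2
    have "((\<lambda>h::real. max 0 h ^ Suc n) \<longlongrightarrow> max 0 0 ^ Suc n) (at 0)"
      by (intro tendsto_intros)
    then have "((\<lambda>h::real. (max 0 h ^ Suc (Suc n) - max 0 0 ^ Suc (Suc n)) / (h - 0)) \<longlongrightarrow> max 0 0 ^ Suc n) (at 0)"
      by (rule Lim_transform_eventually)
        (auto simp: eventually_at_filter max_def intro!: always_eventually)
    then show ?thesis
      using 2 by (simp add: has_field_derivative_iff)
  qed
qed

text \<open>
  A second difference of the cubic ramp. Its second derivative is the second difference of the
  ramp itself, a tent of mass 1 over the interval from \<open>- 2 d\<close> to \<open>0\<close>; so it is a mollified
  negative part that vanishes on the half line of nonnegative numbers.
\<close>

definition smooth_neg :: "real \<Rightarrow> real \<Rightarrow> real" where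
  "smooth_neg d r = (max 0 (- r) ^ 3 - 2 * max 0 (- r - d) ^ 3 + max 0 (- r - 2 * d) ^ 3) / (6 * d\<^sup>2)"

definition smooth_neg' :: "real \<Rightarrow> real \<Rightarrow> real" where
  "smooth_neg' d r = - (max 0 (- r) ^ 2 - 2 * max 0 (- r - d) ^ 2 + max 0 (- r - 2 * d) ^ 2) / (2 * d\<^sup>2)"

definition smooth_neg'' :: "real \<Rightarrow> real \<Rightarrow> real" where
  "smooth_neg'' d r = (max 0 (- r) - 2 * max 0 (- r - d) + max 0 (- r - 2 * d)) / d\<^sup>2"

lemma smooth_neg_has_derivative: "(smooth_neg d has_real_derivative smooth_neg' d r) (at r)"
proof -
  have *: "((\<lambda>r. max 0 (- r - b) ^ 3) has_real_derivative - 3 * max 0 (- r - b) ^ 2) (at r)" for b :: real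
  proof -
    have cube: "((\<lambda>y. max 0 y ^ 3) has_real_derivative 3 * max 0 y ^ 2) (at y)" for y :: real
      using has_derivative_max_0_power[of 1 y] by (simp add: numeral_3_eq_3 numeral_2_eq_2)
    show ?thesis
      by (rule DERIV_chain2[where g = "\<lambda>r. - r - b" and Db = "- 1", THEN DERIV_cong, OF cube])
        (auto intro!: derivative_eq_intros)
  qed
  have "((\<lambda>r. (max 0 (- r - 0) ^ 3 - 2 * max 0 (- r - d) ^ 3 + max 0 (- r - 2 * d) ^ 3) / (6 * d\<^sup>2))
      has_real_derivative (- 3 * max 0 (- r - 0) ^ 2 - 2 * (- 3 * max 0 (- r - d) ^ 2)
        + (- 3 * max 0 (- r - 2 * d) ^ 2)) / (6 * d\<^sup>2)) (at r)"
    by (intro DERIV_cdivide DERIV_add DERIV_diff DERIV_cmult *)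
  moreover have "(- 3 * max 0 (- r - 0) ^ 2 - 2 * (- 3 * max 0 (- r - d) ^ 2)
      + (- 3 * max 0 (- r - 2 * d) ^ 2)) / (6 * d\<^sup>2) = smooth_neg' d r"
    by (cases "d = 0") (simp_all add: smooth_neg'_def field_simps)
  ultimately show ?thesis
    by (simp add: smooth_neg_def[abs_def])
qed

lemma smooth_neg'_has_derivative: "(smooth_neg' d has_real_derivative smooth_neg'' d r) (at r)"
proof -
  have *: "((\<lambda>r. max 0 (- r - b) ^ 2) has_real_derivative - 2 * max 0 (- r - b)) (at r)" for b :: real
    by (rule DERIV_chain2[where g = "\<lambda>r. - r - b" and Db = "- 1", THEN DERIV_cong, OF has_derivative_max_0_power[of 0, folded numeral_2_eq_2]])
      (auto intro!: derivative_eq_intros simp: numeral_2_eq_2)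
  have "((\<lambda>r. - (max 0 (- r - 0) ^ 2 - 2 * max 0 (- r - d) ^ 2 + max 0 (- r - 2 * d) ^ 2) / (2 * d\<^sup>2))
      has_real_derivative - (- 2 * max 0 (- r - 0) - 2 * (- 2 * max 0 (- r - d))
        + (- 2 * max 0 (- r - 2 * d))) / (2 * d\<^sup>2)) (at r)"
    by (intro DERIV_cdivide DERIV_minus DERIV_add DERIV_diff DERIV_cmult *)
  moreover have "- (- 2 * max 0 (- r - 0) - 2 * (- 2 * max 0 (- r - d))
      + (- 2 * max 0 (- r - 2 * d))) / (2 * d\<^sup>2) = smooth_neg'' d r"
    by (cases "d = 0") (simp_all add: smooth_neg''_def field_simps)
  ultimately show ?thesis
    by (simp add: smooth_neg'_def[abs_def])
qed

lemma deriv_smooth_neg: "deriv (smooth_neg d) = smooth_neg' d"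
  using smooth_neg_has_derivative by (blast intro: DERIV_imp_deriv)

lemma deriv_smooth_neg': "deriv (smooth_neg' d) = smooth_neg'' d"
  using smooth_neg'_has_derivative by (blast intro: DERIV_imp_deriv)

context
  fixes d :: real
  assumes d: "0 < d"
begin

lemma smooth_neg''_bounds: "0 \<le> smooth_neg'' d r" "smooth_neg'' d r \<le> 1 / d"
proof -
  have "0 \<le> max 0 (- r) - 2 * max 0 (- r - d) + max 0 (- r - 2 * d)"
    "max 0 (- r) - 2 * max 0 (- r - d) + max 0 (- r - 2 * d) \<le> d"
    using d by (simp_all add: max_def)
  then show "0 \<le> smooth_neg'' d r" "smooth_neg'' d r \<le> 1 / d"
    using d by (auto simp: smooth_neg''_def divide_simps power2_eq_square)
qed

lemma smooth_neg''_support: "smooth_neg'' d r \<noteq> 0 \<Longrightarrow> - 2 * d \<le> r \<and> r \<le> 0"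
  using d by (auto simp: smooth_neg''_def max_def split: if_splits)

lemma smooth_neg_nonneg_arg: "0 \<le> r \<Longrightarrow> smooth_neg d r = 0" "0 \<le> r \<Longrightarrow> smooth_neg' d r = 0"
  using d by (auto simp: smooth_neg_def smooth_neg'_def)

lemma smooth_neg'_bounds: "- 1 \<le> smooth_neg' d r" "smooth_neg' d r \<le> 0"
proof -
  have mono: "smooth_neg' d a \<le> smooth_neg' d b" if "a \<le> b" for a b
    using that smooth_neg'_has_derivative smooth_neg''_bounds
    by (blast intro: DERIV_nonneg_imp_nondecreasing)
  have far: "smooth_neg' d r = - 1" if "r \<le> - 2 * d" for r
  proof -
    have "smooth_neg' d r = - ((- r)\<^sup>2 - 2 * (- r - d)\<^sup>2 + (- r - 2 * d)\<^sup>2) / (2 * d\<^sup>2)"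
      using that d by (simp add: smooth_neg'_def max_def)
    also have "\<dots> = - 1"
      using d by (simp add: field_simps power2_eq_square)
    finally show ?thesis .
  qed
  show "- 1 \<le> smooth_neg' d r"
    using mono[of "- 2 * d" r] far[of r] far[of "- 2 * d"] by (cases "r \<le> - 2 * d") auto
  show "smooth_neg' d r \<le> 0"
    using mono[of r 0] smooth_neg_nonneg_arg(2)[of r] smooth_neg_nonneg_arg(2)[of 0] by (cases "r \<le> 0") auto
qed

lemma smooth_neg_bounds:
  "0 \<le> smooth_neg d r" "smooth_neg d r \<le> \<bar>r\<bar>" "max 0 (- r) - 2 * d \<le> smooth_neg d r"
proof -
  have dec: "- smooth_neg d a \<le> - smooth_neg d b" if "a \<le> b" for a b
  proof (rule DERIV_nonneg_imp_nondecreasing[OF that])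
    fix x
    show "\<exists>y. ((\<lambda>r. - smooth_neg d r) has_real_derivative y) (at x) \<and> 0 \<le> y"
      using DERIV_minus[OF smooth_neg_has_derivative[of d x]] smooth_neg'_bounds[of x] by force
  qed
  have slow: "a + smooth_neg d a \<le> b + smooth_neg d b" if "a \<le> b" for a b
  proof (rule DERIV_nonneg_imp_nondecreasing[OF that])
    fix x
    show "\<exists>y. ((\<lambda>r. r + smooth_neg d r) has_real_derivative y) (at x) \<and> 0 \<le> y"
      using DERIV_add[OF DERIV_ident smooth_neg_has_derivative[of d x]] smooth_neg'_bounds[of x] by force
  qed
  show nonneg: "0 \<le> smooth_neg d r"
    using dec[of r 0] smooth_neg_nonneg_arg(1)[of 0] smooth_neg_nonneg_arg(1)[of r] by (cases "r \<le> 0") auto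
  show "smooth_neg d r \<le> \<bar>r\<bar>"
    using slow[of r 0] smooth_neg_nonneg_arg(1)[of 0] smooth_neg_nonneg_arg(1)[of r] by (cases "r \<le> 0") auto
  show "max 0 (- r) - 2 * d \<le> smooth_neg d r"
  proof (cases "r \<le> - 2 * d")
    case True
    have "smooth_neg d r = ((- r) ^ 3 - 2 * (- r - d) ^ 3 + (- r - 2 * d) ^ 3) / (6 * d\<^sup>2)"
      using True d by (simp add: smooth_neg_def max_def)
    also have "\<dots> = - r - d"
      using d by (simp add: field_simps power2_eq_square power3_eq_cube)
    finally show ?thesis
      using True d by simp
  next
    case False
    then show ?thesis
      using nonneg d by linarith
  qed
qed

lemma smooth_neg_entropy: "smooth_neg d \<in> entropies"
proof -
  have "convex_on UNIV (smooth_neg d)"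
    by (rule f''_ge0_imp_convex[OF convex_UNIV smooth_neg_has_derivative smooth_neg'_has_derivative
          smooth_neg''_bounds(1)])
  moreover have "smooth_neg d differentiable (at r)" "smooth_neg' d differentiable (at r)" for r
    using smooth_neg_has_derivative smooth_neg'_has_derivative real_differentiable_def by blast+
  moreover have "continuous_on UNIV (smooth_neg'' d)"
    using d unfolding smooth_neg''_def[abs_def] by (intro continuous_intros) auto
  moreover have "bounded {r. smooth_neg'' d r \<noteq> 0}"
    by (rule bounded_subset[OF bounded_closed_interval[of "- 2 * d" 0]]) (use smooth_neg''_support in auto)
  ultimately show ?thesis
    by (simp add: entropies_def deriv_smooth_neg deriv_smooth_neg' compact_closure)
qed

end

lemma borel_measurable_smooth_neg [measurable]: "smooth_neg d \<in> borel_measurable borel"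
  unfolding smooth_neg_def[abs_def] by measurable

section \<open>The Ito integral has mean zero\<close>

text \<open>
  On a probability space the mean square error bounds the square of the error of the means, so
  limits in \<open>L\<^sub>2\<close> of centered variables are centered. The lemma is applied twice, to the elementary
  approximations of one integral and to the partial sums of the series.
\<close>

lemma (in prob_space) expectation_zero_L2_limit:
  assumes E: "\<And>j. integrable M (E j)" "\<And>j. expectation (E j) = 0"
    and X [measurable]: "X \<in> borel_measurable M"
    and lim: "(\<lambda>j. \<integral>\<^sup>+\<omega>. ennreal ((E j \<omega> - X \<omega>)\<^sup>2) \<partial>M) \<longlonglongrightarrow> 0"
  shows "integrable M X" "expectation X = 0"
proof -
  have close: "integrable M X \<and> \<bar>expectation X\<bar> \<le> e" if "0 < e" for e :: real
  proof -
    have "eventually (\<lambda>j. (\<integral>\<^sup>+\<omega>. ennreal ((E j \<omega> - X \<omega>)\<^sup>2) \<partial>M) < ennreal (e\<^sup>2)) sequentially"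
      using lim that by (intro order_tendstoD(2)) auto
    then obtain j where j: "(\<integral>\<^sup>+\<omega>. ennreal ((E j \<omega> - X \<omega>)\<^sup>2) \<partial>M) < ennreal (e\<^sup>2)"
      by (auto simp: eventually_sequentially)
    define Z where "Z \<omega> = E j \<omega> - X \<omega>" for \<omega>
    have [measurable]: "E j \<in> borel_measurable M"
      using E(1) by auto
    have Z_measurable [measurable]: "Z \<in> borel_measurable M"
      unfolding Z_def by measurable
    have Z2: "integrable M (\<lambda>\<omega>. (Z \<omega>)\<^sup>2)"
      using j unfolding Z_def
      by (intro integrableI_nonneg) (auto simp: less_trans[OF _ ennreal_less_top])
    then have Z: "integrable M Z"
      by (rule square_integrable_imp_integrable[OF Z_measurable])
    have int: "integrable M X"
      using Bochner_Integration.integrable_diff[OF E(1)[of j] Z] by (simp add: Z_def)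
    have "ennreal (expectation (\<lambda>\<omega>. (Z \<omega>)\<^sup>2)) < ennreal (e\<^sup>2)"
      using j by (simp add: Z_def nn_integral_eq_integral[OF Z2, unfolded Z_def])
    then have "expectation (\<lambda>\<omega>. (Z \<omega>)\<^sup>2) < e\<^sup>2"
      by (simp add: ennreal_less_iff)
    then have "(expectation Z)\<^sup>2 \<le> e\<^sup>2"
      using variance_positive[of Z] variance_eq[OF Z Z2] by linarith
    moreover have "expectation Z = - expectation X"
      using Bochner_Integration.integral_diff[OF E(1)[of j] int] E(2)[of j] by (simp add: Z_def[abs_def])
    ultimately have "\<bar>expectation X\<bar> \<le> \<bar>e\<bar>"
      by (simp add: abs_le_square_iff)
    then show ?thesis
      using int that by simp
  qed
  show "integrable M X"
    using close[of 1] by simp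
  have "\<bar>expectation X\<bar> \<le> 0"
    by (rule field_le_epsilon) (use close in simp)
  then show "expectation X = 0"
    by simp
qed

lemma filtered_prob_spaceD:
  assumes "complete_filtered_prob_space M Fil"
  shows "prob_space M" "space (Fil s) = space M" "sets (Fil s) \<subseteq> sets M"
  using assms unfolding complete_filtered_prob_space_def filtration_def by auto

text \<open>
  Each coefficient of an elementary process is independent of the Wiener increment that it
  multiplies, and the increment is centered.
\<close>

lemma elementary_term_expectation_zero:
  assumes filtered: "complete_filtered_prob_space M Fil"
    and wiener: "wiener_process M Fil T B"
    and times: "0 \<le> s" "s \<le> t" "t \<le> T"
    and c: "c \<in> borel_measurable (Fil s)" "bounded (c ` space M)"
  shows "integrable M (\<lambda>\<omega>. c \<omega> * (B \<omega> t - B \<omega> s))" "(\<integral>\<omega>. c \<omega> * (B \<omega> t - B \<omega> s) \<partial>M) = 0"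
proof -
  interpret prob_space M
    using filtered_prob_spaceD(1)[OF filtered] .
  have "integrable M (\<lambda>\<omega>. c \<omega> * (B \<omega> t - B \<omega> s)) \<and> (\<integral>\<omega>. c \<omega> * (B \<omega> t - B \<omega> s) \<partial>M) = 0"
  proof (cases "s = t")
    case False
    define D where "D \<omega> = B \<omega> t - B \<omega> s" for \<omega>
    have distr: "distributed M lborel D (normal_density 0 (sqrt (t - s)))"
      and indep: "indep_set (sets (Fil s)) (sets (vimage_algebra (space M) D borel))"
      using wiener times False unfolding wiener_process_def D_def by auto
    have D_measurable: "random_variable borel D"
      using distributed_measurable[OF distr] by simp
    have c_measurable: "random_variable borel c"
      using filtered_prob_spaceD(2,3)[OF filtered]
      by (intro measurable_from_subalg[OF _ c(1)]) (simp add: subalgebra_def)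
    have "indep_var borel c borel D"
      unfolding indep_var_eq
    proof (intro conjI c_measurable D_measurable)
      have "sigma_sets (space M) {c -` A \<inter> space M | A. A \<in> sets borel} \<subseteq> sets (Fil s)"
      proof -
        have "{c -` A \<inter> space M | A. A \<in> sets borel} \<subseteq> sets (Fil s)"
          using measurable_sets[OF c(1)] filtered_prob_spaceD(2)[OF filtered] by auto
        from sets.sigma_sets_subset[OF this] show ?thesis
          using filtered_prob_spaceD(2)[OF filtered] by simp
      qed
      then show "indep_set (sigma_sets (space M) {c -` A \<inter> space M | A. A \<in> sets borel})
          (sigma_sets (space M) {D -` A \<inter> space M | A. A \<in> sets borel})"
        using indep unfolding sets_vimage_algebra indep_set_def
        by (elim indep_sets_mono_sets) (auto split: bool.splits)
    qed
    moreover have "integrable M c"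
    proof -
      obtain b where "\<forall>\<omega>\<in>space M. norm (c \<omega>) \<le> b"
        using c(2) unfolding bounded_iff by auto
      then show ?thesis
        using c_measurable by (intro integrable_const_bound[where B = b]) auto
    qed
    moreover have "integrable M D"
    proof -
      have "integrable lborel (\<lambda>x. normal_density 0 (sqrt (t - s)) x * x)"
        using integrable_normal_moment_nz_1[of "sqrt (t - s)" 0] times False by simp
      then show ?thesis
        using distributed_integrable[OF distr, of "\<lambda>x. x"] by simp
    qed
    moreover have "expectation D = 0"
      using normal_distributed_expectation[OF _ distr] times False by simp
    ultimately show ?thesis
      using indep_var_integrable indep_var_lebesgue_integral[of c D] by (simp add: D_def[abs_def])
  qed simp
  then show "integrable M (\<lambda>\<omega>. c \<omega> * (B \<omega> t - B \<omega> s))" "(\<integral>\<omega>. c \<omega> * (B \<omega> t - B \<omega> s) \<partial>M) = 0"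
    by auto
qed

lemma elementary_integral_expectation_zero:
  assumes filtered: "complete_filtered_prob_space M Fil"
    and wiener: "wiener_process M Fil T B"
    and elementary: "elementary Fil (space M) T n p c"
  shows "integrable M (elementary_integral B n p c)" "(\<integral>\<omega>. elementary_integral B n p c \<omega> \<partial>M) = 0"
proof -
  have step: "\<And>i. i < n \<Longrightarrow> p i \<le> p (Suc i)" and ends: "0 \<le> p 0" "p n \<le> T"
    and c: "\<And>i. i < n \<Longrightarrow> c i \<in> borel_measurable (Fil (p i)) \<and> bounded (c i ` space M)"
    using elementary unfolding elementary_def by auto
  have low: "0 \<le> p i" if "i \<le> n" for i
    using that
  proof (induction i)
    case (Suc i)
    then show ?case using step[of i] by simp
  qed (use ends in simp)
  have high: "p i \<le> T" if "i \<le> n" for i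
    using that
  proof (induction i rule: inc_induct)
    case (step i)
    then show ?case using \<open>\<And>i. i < n \<Longrightarrow> p i \<le> p (Suc i)\<close>[of i] by simp
  qed (use ends in simp)
  have "integrable M (\<lambda>\<omega>. c i \<omega> * (B \<omega> (p (Suc i)) - B \<omega> (p i)))
      \<and> (\<integral>\<omega>. c i \<omega> * (B \<omega> (p (Suc i)) - B \<omega> (p i)) \<partial>M) = 0" if "i < n" for i
    using elementary_term_expectation_zero[OF filtered wiener low step high] c that by auto
  then show "integrable M (elementary_integral B n p c)" "(\<integral>\<omega>. elementary_integral B n p c \<omega> \<partial>M) = 0"
    by (auto simp: elementary_integral_def[abs_def])
qed

lemma ito_series_expectation_zero:
  assumes filtered: "complete_filtered_prob_space M Fil"
    and wiener: "\<And>k. wiener_process M Fil T (W k)"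
    and ito: "has_ito_series M Fil W T g X"
  shows "integrable M X" "(\<integral>\<omega>. X \<omega> \<partial>M) = 0"
proof -
  interpret prob_space M
    using filtered_prob_spaceD(1)[OF filtered] .
  obtain Y where X: "X \<in> borel_measurable M"
    and Y: "\<And>k. has_ito_integral M Fil (W k) T (g k) (Y k)"
    and lim: "(\<lambda>n. \<integral>\<^sup>+\<omega>. ennreal (((\<Sum>k<n. Y k \<omega>) - X \<omega>)\<^sup>2) \<partial>M) \<longlonglongrightarrow> 0"
    using ito unfolding has_ito_series_def by auto
  have mean: "integrable M (Y k) \<and> expectation (Y k) = 0" for k
  proof -
    obtain n p c where Yk: "Y k \<in> borel_measurable M"
      and el: "\<And>j. elementary Fil (space M) T (n j) (p j) (c j)"
      and lim: "(\<lambda>j. \<integral>\<^sup>+\<omega>. ennreal ((elementary_integral (W k) (n j) (p j) (c j) \<omega> - Y k \<omega>)\<^sup>2) \<partial>M) \<longlonglongrightarrow> 0"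
      using Y[of k] unfolding has_ito_integral_def by auto
    show ?thesis
      using expectation_zero_L2_limit[OF elementary_integral_expectation_zero[OF filtered wiener el] Yk lim]
      by simp
  qed
  then have "integrable M (\<lambda>\<omega>. \<Sum>k<n. Y k \<omega>)" "expectation (\<lambda>\<omega>. \<Sum>k<n. Y k \<omega>) = 0" for n
    by auto
  from expectation_zero_L2_limit[OF this X lim]
  show "integrable M X" "(\<integral>\<omega>. X \<omega> \<partial>M) = 0" .
qed

section \<open>Measurability and integrability of predictable fields\<close>

lemma torus_cube_measurable [measurable]: "{x::real^'n. \<forall>i. 0 \<le> x $ i \<and> x $ i < 1} \<in> sets borel"
  by measurable

lemma finite_measure_torus: "finite_measure (torus :: (real^'n) measure)"
proof
  have "emeasure lborel {x::real^'n. \<forall>i. 0 \<le> x $ i \<and> x $ i < 1} \<le> emeasure lborel (cbox (0::real^'n) 1)"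
    by (rule emeasure_mono) (auto simp: mem_box_cart less_imp_le)
  also have "\<dots> < \<infinity>"
    using emeasure_lborel_cbox_finite by (simp add: less_top)
  finally show "emeasure (torus :: (real^'n) measure) (space torus) \<noteq> \<infinity>"
    by (simp add: torus_def space_restrict_space emeasure_restrict_space)
qed

lemma finite_measure_interval: "finite_measure (interval_measure_to T)"
proof
  show "emeasure (interval_measure_to T) (space (interval_measure_to T)) \<noteq> \<infinity>"
    by (cases "0 \<le> T") (auto simp: interval_measure_to_def space_restrict_space emeasure_restrict_space)
qed

lemma finite_measure_QT: "finite_measure (QT T :: (real \<times> (real^'n)) measure)"
  unfolding QT_def by (rule finite_measure_pair_measure[OF finite_measure_torus finite_measure_interval])

lemma space_interval_measure_to: "space (interval_measure_to T) = {0..T}"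
  by (simp add: interval_measure_to_def space_restrict_space)

lemma interval_measure_to_sets: "J \<in> sets borel \<Longrightarrow> J \<inter> {0..T} \<in> sets (interval_measure_to T)"
  by (auto simp: interval_measure_to_def sets_restrict_space)

lemma fst_measurable_QT [measurable]: "fst \<in> borel_measurable (QT T)"
proof -
  have "(\<lambda>x. x) \<in> borel_measurable (interval_measure_to T)"
    unfolding interval_measure_to_def by (intro measurable_restrict_space1) simp
  then show ?thesis
    unfolding QT_def by measurable
qed

lemma AE_QT_time: "(AE p in QT T. 0 \<le> fst p \<and> fst p \<le> T)"
  by (rule AE_I2) (auto simp: QT_def space_pair_measure space_interval_measure_to)

text \<open>
  The predictable sigma-algebra is coarser than the product sigma-algebra. So predictable fields
  are jointly measurable, which is what integrating over paths first and then over \<open>\<omega>\<close> requires.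
\<close>

lemma identity_measurable_predictable:
  assumes filtered: "complete_filtered_prob_space M Fil" and T: "0 \<le> T"
  shows "(\<lambda>p. p) \<in> measurable (M \<Otimes>\<^sub>M interval_measure_to T) (predictable M Fil T)"
  unfolding predictable_def
proof (rule measurable_measure_of)
  let ?G = "{A \<times> {0} | A. A \<in> sets (Fil 0)}
      \<union> {A \<times> {s<..t} | A s t. 0 \<le> s \<and> s < t \<and> t \<le> T \<and> A \<in> sets (Fil s)}"
  have adapted: "A \<in> sets M" if "A \<in> sets (Fil s)" for A s
    using filtered_prob_spaceD(3)[OF filtered, of s] that by blast
  show "(\<lambda>p. p) \<in> space (M \<Otimes>\<^sub>M interval_measure_to T) \<rightarrow> space M \<times> {0..T}"
    by (auto simp: space_pair_measure space_interval_measure_to)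
  fix y assume "y \<in> ?G"
  then obtain A J where y: "y = A \<times> J" and A: "A \<in> sets M" and J: "J \<in> sets borel"
    using adapted by auto
  have "(\<lambda>p. p) -` y \<inter> space (M \<Otimes>\<^sub>M interval_measure_to T) = A \<times> (J \<inter> {0..T})"
    using sets.sets_into_space[OF A] by (auto simp: y space_pair_measure space_interval_measure_to)
  then show "(\<lambda>p. p) -` y \<inter> space (M \<Otimes>\<^sub>M interval_measure_to T) \<in> sets (M \<Otimes>\<^sub>M interval_measure_to T)"
    using A interval_measure_to_sets[OF J] by simp
next
  have sub: "A \<subseteq> space M" if "A \<in> sets (Fil s)" for A s
    using sets.sets_into_space[OF that] filtered_prob_spaceD(2)[OF filtered] by simp
  have "A \<times> {0} \<in> Pow (space M \<times> {0..T})" if "A \<in> sets (Fil 0)" for A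
    using sub[OF that] T by auto
  moreover have "A \<times> {s<..t} \<in> Pow (space M \<times> {0..T})"
    if "0 \<le> s" "t \<le> T" "A \<in> sets (Fil s)" for A s t
    using sub[OF that(3)] that(1,2) by auto
  ultimately show "{A \<times> {0} | A. A \<in> sets (Fil 0)}
      \<union> {A \<times> {s<..t} | A s t. 0 \<le> s \<and> s < t \<and> t \<le> T \<and> A \<in> sets (Fil s)}
      \<subseteq> Pow (space M \<times> {0..T})"
    by (intro Un_least subsetI) (elim CollectE exE conjE, simp)+
qed

lemma predictable_field_measurable:
  fixes v :: "'a \<Rightarrow> real \<Rightarrow> real^'n \<Rightarrow> real"
  assumes filtered: "complete_filtered_prob_space M Fil" and T: "0 \<le> T"
    and v: "predictable_field M Fil T v"
  shows "(\<lambda>(\<omega>, p). v \<omega> (fst p) (snd p)) \<in> borel_measurable (M \<Otimes>\<^sub>M QT T)"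
proof -
  have id_torus: "(\<lambda>x. x) \<in> measurable (torus :: (real^'n) measure) borel"
    unfolding torus_def by (intro measurable_restrict_space1) simp
  have "(\<lambda>q. (fst q, fst (snd q))) \<in> measurable (M \<Otimes>\<^sub>M QT T) (M \<Otimes>\<^sub>M interval_measure_to T)"
    unfolding QT_def by measurable
  from measurable_compose[OF this identity_measurable_predictable[OF filtered T]]
  have "(\<lambda>q. (fst q, fst (snd q))) \<in> measurable (M \<Otimes>\<^sub>M QT T) (predictable M Fil T)"
    by simp
  moreover have "(\<lambda>q. snd (snd q)) \<in> measurable (M \<Otimes>\<^sub>M (QT T :: (real \<times> (real^'n)) measure)) torus"
    unfolding QT_def by measurable
  from measurable_compose[OF this id_torus]
  have "(\<lambda>q. snd (snd q)) \<in> measurable (M \<Otimes>\<^sub>M (QT T :: (real \<times> (real^'n)) measure)) borel"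
    by simp
  ultimately have "(\<lambda>q. ((fst q, fst (snd q)), snd (snd q)))
      \<in> measurable (M \<Otimes>\<^sub>M (QT T :: (real \<times> (real^'n)) measure)) (predictable M Fil T \<Otimes>\<^sub>M borel)"
    by (rule measurable_Pair)
  moreover have "(\<lambda>((\<omega>, t), x). v \<omega> t x) \<in> borel_measurable (predictable M Fil T \<Otimes>\<^sub>M borel)"
    using v unfolding predictable_field_def by blast
  ultimately show ?thesis
    by (rule measurable_compose[THEN measurable_cong[THEN iffD1, rotated]]) (simp add: case_prod_beta)
qed

lemma Lp_field_pathwise:
  fixes v :: "'a \<Rightarrow> real \<Rightarrow> real^'n \<Rightarrow> real"
  assumes filtered: "complete_filtered_prob_space M Fil" and T: "0 \<le> T"
    and v: "Lp_field M Fil T p v"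
  shows "AE \<omega> in M. (\<lambda>q. v \<omega> (fst q) (snd q)) \<in> borel_measurable (QT T)
      \<and> integrable (QT T) (\<lambda>q. \<bar>v \<omega> (fst q) (snd q)\<bar> powr p)"
proof -
  interpret Q: finite_measure "QT T :: (real \<times> (real^'n)) measure"
    by (rule finite_measure_QT)
  have joint [measurable]: "(\<lambda>(\<omega>, p). v \<omega> (fst p) (snd p)) \<in> borel_measurable (M \<Otimes>\<^sub>M QT T)"
    using predictable_field_measurable[OF filtered T] v unfolding Lp_field_def by blast
  have slice: "(\<lambda>q. v \<omega> (fst q) (snd q)) \<in> borel_measurable (QT T)" if "\<omega> \<in> space M" for \<omega>
    using measurable_compose[OF measurable_Pair1'[OF that] joint] by simp
  have "(\<lambda>(\<omega>, p'). ennreal (\<bar>v \<omega> (fst p') (snd p')\<bar> powr p)) \<in> borel_measurable (M \<Otimes>\<^sub>M QT T)"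
    using joint unfolding case_prod_beta by measurable
  then have "(\<lambda>\<omega>. \<integral>\<^sup>+q. ennreal (\<bar>v \<omega> (fst q) (snd q)\<bar> powr p) \<partial>QT T) \<in> borel_measurable M"
    by (rule Q.borel_measurable_nn_integral)
  moreover have "(\<integral>\<^sup>+\<omega>. (\<integral>\<^sup>+q. ennreal (\<bar>v \<omega> (fst q) (snd q)\<bar> powr p) \<partial>QT T) \<partial>M) \<noteq> \<infinity>"
  proof -
    have "(\<integral>\<^sup>+\<omega>. (\<integral>\<^sup>+q. ennreal (\<bar>v \<omega> (fst q) (snd q)\<bar> powr p) \<partial>QT T) \<partial>M)
        = (\<integral>\<^sup>+\<omega>. (\<integral>\<^sup>+(t, x). ennreal (norm (v \<omega> t x) powr p) \<partial>QT T) \<partial>M)"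
      by (intro nn_integral_cong) (simp add: case_prod_beta)
    then show ?thesis
      using v unfolding Lp_field_def by (metis less_irrefl)
  qed
  ultimately have "AE \<omega> in M. (\<integral>\<^sup>+q. ennreal (\<bar>v \<omega> (fst q) (snd q)\<bar> powr p) \<partial>QT T) \<noteq> \<infinity>"
    by (rule nn_integral_PInf_AE)
  then show ?thesis
  proof (rule AE_mp, intro AE_I2 impI conjI)
    fix \<omega> assume \<omega>: "\<omega> \<in> space M"
      and fin: "(\<integral>\<^sup>+q. ennreal (\<bar>v \<omega> (fst q) (snd q)\<bar> powr p) \<partial>QT T) \<noteq> \<infinity>"
    show meas [measurable]: "(\<lambda>q. v \<omega> (fst q) (snd q)) \<in> borel_measurable (QT T)"
      by (rule slice[OF \<omega>])
    show "integrable (QT T) (\<lambda>q. \<bar>v \<omega> (fst q) (snd q)\<bar> powr p)"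
      using fin by (intro integrableI_nonneg) (auto simp: less_top)
  qed
qed

lemma (in finite_measure) integrable_square_of_powr:
  fixes f :: "'a \<Rightarrow> real"
  assumes [measurable]: "f \<in> borel_measurable M" and f: "integrable M (\<lambda>x. \<bar>f x\<bar> powr p)" and p: "2 \<le> p"
  shows "integrable M (\<lambda>x. (f x)\<^sup>2)"
proof (rule Bochner_Integration.integrable_bound)
  show "integrable M (\<lambda>x. 1 + \<bar>f x\<bar> powr p)"
    using f by simp
  show "AE x in M. norm ((f x)\<^sup>2) \<le> norm (1 + \<bar>f x\<bar> powr p)"
  proof (rule AE_I2)
    fix x
    have "(f x)\<^sup>2 = \<bar>f x\<bar> powr 2" if "f x \<noteq> 0"
      using that by (simp add: powr_numeral)
    moreover have "\<bar>f x\<bar> powr 2 \<le> \<bar>f x\<bar> powr p" if "1 \<le> \<bar>f x\<bar>"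
      using that p by (intro powr_mono) auto
    moreover have "(f x)\<^sup>2 \<le> 1" if "\<bar>f x\<bar> \<le> 1"
      using that by (simp add: abs_square_le_1)
    ultimately have "(f x)\<^sup>2 \<le> 1 + \<bar>f x\<bar> powr p"
      by (cases "1 \<le> \<bar>f x\<bar>") (auto simp: add_increasing2 add_increasing)
    then show "norm ((f x)\<^sup>2) \<le> norm (1 + \<bar>f x\<bar> powr p)"
      by simp
  qed
qed measurable

lemma AE_QT_before_end: "AE q in (QT T :: (real \<times> (real^'n)) measure). fst q \<noteq> T"
proof (rule AE_I)
  interpret X: finite_measure "torus :: (real^'n) measure"
    by (rule finite_measure_torus)
  let ?J = "{T} \<inter> {0..T}"
  have J: "?J \<in> sets (interval_measure_to T)"
    by (rule interval_measure_to_sets) simp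
  have "emeasure (interval_measure_to T) ?J = emeasure lborel ?J"
    unfolding interval_measure_to_def by (rule emeasure_restrict_space) auto
  also have "\<dots> \<le> emeasure lborel {T}"
    by (rule emeasure_mono) auto
  finally have null: "emeasure (interval_measure_to T) ?J = 0"
    by simp
  show "{q \<in> space (QT T). \<not> fst q \<noteq> T} \<subseteq> ?J \<times> space (torus :: (real^'n) measure)"
    unfolding QT_def space_pair_measure space_interval_measure_to by (auto simp del: Int_insert_left)
  show "?J \<times> space (torus :: (real^'n) measure) \<in> sets (QT T)"
    unfolding QT_def by (rule pair_measureI[OF J sets.top])
  show "emeasure (QT T) (?J \<times> space (torus :: (real^'n) measure)) = 0"
    unfolding QT_def X.emeasure_pair_measure_Times[OF J sets.top] null by simp
qed

section \<open>Pathwise estimates\<close>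

text \<open>
  The reflection term acts only on the contact set, and a nonnegative obstacle keeps that set away
  from the region where the solution is negative. The moment bounds are what makes the
  vanishing integral in the complementarity condition a genuine one: both factors are square
  integrable, so the integrand, which has a sign, vanishes almost everywhere.
\<close>

lemma reflection_vanishes_where_negative:
  fixes v n :: "real \<times> (real^'n) \<Rightarrow> real"
  assumes v [measurable]: "v \<in> borel_measurable (QT T)" and v2: "integrable (QT T) (\<lambda>q. (v q)\<^sup>2)"
    and n [measurable]: "n \<in> borel_measurable (QT T)" and n2: "integrable (QT T) (\<lambda>q. (n q)\<^sup>2)"
    and s: "continuous_on {0..T} s" "\<And>t. t \<in> {0..T} \<Longrightarrow> 0 \<le> s t"
    and below: "AE q in QT T. v q \<le> s (fst q)"
    and n_nonneg: "AE q in QT T. 0 \<le> n q"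
    and contact: "(\<integral>q. (v q - s (fst q)) * n q \<partial>QT T) = 0"
  shows "AE q in QT T. v q < 0 \<longrightarrow> n q = 0"
proof -
  interpret Q: finite_measure "QT T :: (real \<times> (real^'n)) measure"
    by (rule finite_measure_QT)
  have "s \<in> borel_measurable (interval_measure_to T)"
    using borel_measurable_continuous_on_restrict[OF s(1)]
    by (simp add: interval_measure_to_def cong: measurable_cong_sets sets_restrict_space_cong)
  then have s_measurable [measurable]: "(\<lambda>q. s (fst q)) \<in> borel_measurable (QT T)"
    unfolding QT_def by measurable
  obtain b where b: "\<And>t. t \<in> {0..T} \<Longrightarrow> \<bar>s t\<bar> \<le> b"
    using compact_imp_bounded[OF compact_continuous_image[OF s(1) compact_Icc]]
    unfolding bounded_iff by (metis imageI real_norm_def)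
  have gap: "integrable (QT T) (\<lambda>q. (s (fst q) - v q) * n q)"
  proof (rule Bochner_Integration.integrable_bound)
    show "integrable (QT T) (\<lambda>q. 2 * b\<^sup>2 + 2 * (v q)\<^sup>2 + (n q)\<^sup>2)"
      using v2 n2 by simp
    show "AE q in QT T. norm ((s (fst q) - v q) * n q) \<le> norm (2 * b\<^sup>2 + 2 * (v q)\<^sup>2 + (n q)\<^sup>2)"
      using AE_QT_time
    proof (rule AE_mp, intro AE_I2 impI)
      fix q :: "real \<times> (real^'n)" assume "0 \<le> fst q \<and> fst q \<le> T"
      then have "\<bar>s (fst q)\<bar> \<le> \<bar>b\<bar>"
        using b[of "fst q"] by auto
      then have "(s (fst q))\<^sup>2 \<le> b\<^sup>2"
        by (simp add: abs_le_square_iff)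
      moreover have "(s (fst q) - v q)\<^sup>2 \<le> 2 * (s (fst q))\<^sup>2 + 2 * (v q)\<^sup>2"
        using zero_le_power2[of "s (fst q) + v q"] by (simp add: power2_eq_square algebra_simps)
      moreover have "2 * (\<bar>s (fst q) - v q\<bar> * \<bar>n q\<bar>) \<le> (s (fst q) - v q)\<^sup>2 + (n q)\<^sup>2"
        using sum_squares_bound[of "\<bar>s (fst q) - v q\<bar>" "\<bar>n q\<bar>"] by (simp add: mult.assoc)
      moreover have "0 \<le> \<bar>s (fst q) - v q\<bar> * \<bar>n q\<bar>"
        by simp
      ultimately have "\<bar>s (fst q) - v q\<bar> * \<bar>n q\<bar> \<le> 2 * b\<^sup>2 + 2 * (v q)\<^sup>2 + (n q)\<^sup>2"
        by linarith
      then show "norm ((s (fst q) - v q) * n q) \<le> norm (2 * b\<^sup>2 + 2 * (v q)\<^sup>2 + (n q)\<^sup>2)"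
        by (simp add: abs_mult)
    qed
  qed measurable
  have "AE q in QT T. 0 \<le> (s (fst q) - v q) * n q"
    using below n_nonneg by eventually_elim simp
  moreover have "(\<integral>q. (s (fst q) - v q) * n q \<partial>QT T) = 0"
    using contact Bochner_Integration.integral_minus[of "QT T" "\<lambda>q. (v q - s (fst q)) * n q"]
    by (simp add: algebra_simps)
  ultimately have "AE q in QT T. (s (fst q) - v q) * n q = 0"
    using integral_nonneg_eq_0_iff_AE[OF gap] by simp
  then show ?thesis
    using AE_QT_time by eventually_elim (use s(2) in fastforce)
qed

text \<open>
  On the support of \<open>smooth_neg'' d\<close>, of width \<open>2 d\<close>, the squared noise coefficient is of order
  \<open>d powr (1 + 2 * \<kappa>)\<close>; this beats the height \<open>1 / d\<close>. Here the Hoelder exponent above one half is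
  essential.
\<close>

lemma ito_correction_small:
  assumes noise: "noise_assms \<kappa> K \<sigma>" and \<kappa>: "0 < \<kappa>" "\<kappa> \<le> 1/2" and K: "1 \<le> K" and d: "0 < d" "2 * d \<le> 1"
  shows "1/2 * smooth_neg'' d r * (\<Sum>k. (\<sigma> k r)\<^sup>2) \<le> 4 * K\<^sup>2 * (2 * d) powr (2 * \<kappa>)"
proof (cases "smooth_neg'' d r = 0")
  case False
  then have r: "\<bar>r\<bar> \<le> 2 * d"
    using smooth_neg''_support[OF d(1)] by force
  define A where "A = (\<Sum>k. (\<sigma> k r)\<^sup>2)"
  have A_nonneg: "0 \<le> A"
    using noise unfolding A_def noise_assms_def by (auto intro: suminf_nonneg)
  have "sqrt (\<Sum>k. (\<sigma> k r - \<sigma> k 0)\<^sup>2) \<le> K * (\<bar>r - 0\<bar> powr (1/2 + \<kappa>) + \<bar>r - 0\<bar>)" and "\<forall>k. \<sigma> k 0 = 0"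
    using noise unfolding noise_assms_def by blast+
  then have "sqrt A \<le> K * (\<bar>r\<bar> powr (1/2 + \<kappa>) + \<bar>r\<bar>)"
    by (simp add: A_def)
  also have "\<dots> \<le> K * (2 * (2 * d) powr (1/2 + \<kappa>))"
  proof (intro mult_left_mono)
    have "\<bar>r\<bar> powr (1/2 + \<kappa>) \<le> (2 * d) powr (1/2 + \<kappa>)"
      using r \<kappa> by (intro powr_mono2) auto
    moreover have "2 * d \<le> (2 * d) powr (1/2 + \<kappa>)"
      using powr_mono'[of "1/2 + \<kappa>" 1 "2 * d"] d \<kappa> by simp
    ultimately show "\<bar>r\<bar> powr (1/2 + \<kappa>) + \<bar>r\<bar> \<le> 2 * (2 * d) powr (1/2 + \<kappa>)"
      using r by linarith
  qed (use K in simp)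
  finally have "(sqrt A)\<^sup>2 \<le> (K * (2 * (2 * d) powr (1/2 + \<kappa>)))\<^sup>2"
    using A_nonneg by (intro power_mono) auto
  also have "\<dots> = 4 * K\<^sup>2 * ((2 * d) powr (1/2 + \<kappa>) * (2 * d) powr (1/2 + \<kappa>))"
    by (simp add: power2_eq_square)
  also have "(2 * d) powr (1/2 + \<kappa>) * (2 * d) powr (1/2 + \<kappa>) = 2 * d * (2 * d) powr (2 * \<kappa>)"
  proof -
    have "(2 * d) powr (1/2 + \<kappa>) * (2 * d) powr (1/2 + \<kappa>) = (2 * d) powr (1 + 2 * \<kappa>)"
      by (simp flip: powr_add)
    also have "\<dots> = 2 * d * (2 * d) powr (2 * \<kappa>)"
      using d by (subst powr_add) simp
    finally show ?thesis .
  qed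
  finally have A: "A \<le> 4 * K\<^sup>2 * (2 * d * (2 * d) powr (2 * \<kappa>))"
    using A_nonneg by simp
  \<comment> \<open>The height \<open>1 / d\<close> of the tent cancels one power of \<open>d\<close> and leaves the exponent \<open>2 * \<kappa>\<close>.\<close>
  have "1/2 * smooth_neg'' d r * A \<le> 1/2 * (1 / d) * (4 * K\<^sup>2 * (2 * d * (2 * d) powr (2 * \<kappa>)))"
    using smooth_neg''_bounds[OF d(1)] d A A_nonneg by (intro mult_mono) auto
  also have "\<dots> = 4 * K\<^sup>2 * (2 * d) powr (2 * \<kappa>)"
    using d by simp
  finally show ?thesis
    by (simp add: A_def)
qed simp

definition neg_part_error :: "real \<Rightarrow> real \<Rightarrow> real \<Rightarrow> real \<Rightarrow> real" where
  "neg_part_error \<kappa> K N0 d = 2 * d * (N0 + 2) + 4 * K\<^sup>2 * (2 * d) powr (2 * \<kappa>)"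

lemma neg_part_error_tendsto_0:
  assumes "0 < \<kappa>"
  shows "(neg_part_error \<kappa> K N0 \<longlongrightarrow> 0) (at_right 0)"
proof -
  have lin: "((\<lambda>d::real. 2 * d) \<longlongrightarrow> 2 * 0) (at_right 0)"
    by (intro tendsto_intros)
  have pow: "((\<lambda>d. (2 * d) powr (2 * \<kappa>)) \<longlongrightarrow> (2 * 0) powr (2 * \<kappa>)) (at_right 0)"
    using assms by (intro tendsto_powr'[OF lin tendsto_const] disjI2 conjI) (auto simp: eventually_at_filter)
  have "((\<lambda>d. 2 * d * (N0 + 2) + 4 * K\<^sup>2 * (2 * d) powr (2 * \<kappa>))
      \<longlongrightarrow> 2 * 0 * (N0 + 2) + 4 * K\<^sup>2 * (2 * 0) powr (2 * \<kappa>)) (at_right 0)"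
    by (intro tendsto_add tendsto_mult tendsto_const lin pow)
  then show ?thesis
    by (simp add: neg_part_error_def[abs_def])
qed

text \<open>
  The deterministic part of the argument. The weight turns the left-hand side of the entropy
  inequality into \<open>N0 \<phi> + \<psi>\<close> times the regularized negative part, and the Lipschitz source can
  consume at most \<open>N0 \<phi>\<close> times the negative part. What survives is the integral against the
  surplus \<open>\<psi>\<close>. The gradient term has a favourable sign. Since the integral of a function that is
  not integrable is 0, a nonnegative integrable majorant always bounds the integral; the source
  and gradient terms are estimated in this way.
\<close>

lemma neg_part_pathwise_bound:
  fixes v n :: "real \<Rightarrow> real^'n \<Rightarrow> real" and G :: "real \<Rightarrow> real^'n \<Rightarrow> real^'n"
    and F :: "real \<Rightarrow> real^'n \<Rightarrow> real \<Rightarrow> real" and x0 :: "real^'n \<Rightarrow> real" and c N0 :: real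
  defines "\<phi> \<equiv> flat_exp N0 c 1" and "\<psi> \<equiv> flat_exp N0 c [:0, 0, 1:]"
  assumes N0: "0 \<le> N0" and d: "0 < d" "2 * d \<le> 1"
    and noise: "noise_assms \<kappa> K \<sigma>" "0 < \<kappa>" "\<kappa> \<le> 1/2" "1 \<le> K"
    and source: "source_assms T \<kappa>' K N0 F"
    and v: "integrable (QT T) (\<lambda>q. v (fst q) (snd q))"
    and reflection: "AE q in QT T. v (fst q) (snd q) < 0 \<longrightarrow> n (fst q) (snd q) = 0"
    and initial: "AE x in torus. 0 \<le> x0 x"
    and entropy: "- (\<integral>(t, x). smooth_neg d (v t x) * (deriv \<phi> t * 1) \<partial>QT T)
            \<le> (\<integral>x. smooth_neg d (x0 x) * (\<phi> 0 * 1) \<partial>torus)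
              + (\<integral>(t, x). P (v t x) * (\<phi> t * laplacian (\<lambda>_::real^'n. 1) x) \<partial>QT T)
              + (\<integral>(t, x). smooth_neg' d (v t x) * (F t x (v t x) - n t x) * (\<phi> t * 1) \<partial>QT T)
              + (\<integral>(t, x). 1/2 * smooth_neg'' d (v t x) * (\<Sum>k. (\<sigma> k (v t x))\<^sup>2) * (\<phi> t * 1)
                    - smooth_neg'' d (v t x) * (norm (G t x))\<^sup>2 * (\<phi> t * 1) \<partial>QT T)
              + X"
  shows "integrable (QT T) (\<lambda>q. max 0 (- v (fst q) (snd q)) * \<psi> (fst q))"
    and "(\<integral>q. max 0 (- v (fst q) (snd q)) * \<psi> (fst q) \<partial>QT T)
      \<le> neg_part_error \<kappa> K N0 d * measure (QT T) (space (QT T :: (real \<times> (real^'n)) measure)) + X"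
proof -
  let ?Q = "QT T :: (real \<times> (real^'n)) measure"
  define w where "w q = v (fst q) (snd q)" for q
  interpret Q: finite_measure ?Q
    by (rule finite_measure_QT)
  have w [measurable]: "w \<in> borel_measurable ?Q" and w_int: "integrable ?Q w"
    using v by (auto simp: w_def[abs_def])
  have \<phi>: "0 \<le> \<phi> t" "\<phi> t \<le> 1" and \<psi>: "0 \<le> \<psi> t" "\<psi> t \<le> 2" if "0 \<le> t" for t
    using flat_exp_one_bounds[OF N0 that] flat_exp_square_bounds[OF N0 that] by (auto simp: \<phi>_def \<psi>_def)
  have [measurable]: "\<phi> \<in> borel_measurable borel" "\<psi> \<in> borel_measurable borel"
    by (simp_all add: \<phi>_def \<psi>_def)
  have weighted: "integrable ?Q (\<lambda>q. f (w q) * \<theta> (fst q))"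
    if [measurable]: "f \<in> borel_measurable borel" "\<theta> \<in> borel_measurable borel"
      and f: "\<And>r. \<bar>f r\<bar> \<le> \<bar>r\<bar>" and \<theta>: "\<And>t. 0 \<le> t \<Longrightarrow> 0 \<le> \<theta> t \<and> \<theta> t \<le> 2"
    for f \<theta> :: "real \<Rightarrow> real"
  proof (rule Bochner_Integration.integrable_bound)
    show "integrable ?Q (\<lambda>q. \<bar>w q\<bar> * 2)"
      using w_int by simp
    show "AE q in ?Q. norm (f (w q) * \<theta> (fst q)) \<le> norm (\<bar>w q\<bar> * 2)"
      using AE_QT_time
    proof eventually_elim
      case (elim q)
      then show ?case
        using mult_mono[OF f[of "w q"], of "\<bar>\<theta> (fst q)\<bar>" 2] \<theta>[of "fst q"] by (simp add: abs_mult)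
    qed
  qed measurable
  have neg_\<phi>: "integrable ?Q (\<lambda>q. max 0 (- w q) * \<phi> (fst q))"
    and neg_\<psi>: "integrable ?Q (\<lambda>q. max 0 (- w q) * \<psi> (fst q))"
    by (rule weighted; use \<phi> \<psi> in \<open>force simp: max_def\<close>)+
  have eta_\<phi>: "integrable ?Q (\<lambda>q. smooth_neg d (w q) * \<phi> (fst q))"
    and eta_\<psi>: "integrable ?Q (\<lambda>q. smooth_neg d (w q) * \<psi> (fst q))"
    by (rule weighted; use \<phi> \<psi> smooth_neg_bounds[OF d(1)] in \<open>force simp: abs_of_nonneg\<close>)+
  show "integrable (QT T) (\<lambda>q. max 0 (- v (fst q) (snd q)) * \<psi> (fst q))"
    using neg_\<psi> by (simp add: w_def)

  have lhs: "(\<integral>q. N0 * (max 0 (- w q) * \<phi> (fst q)) + max 0 (- w q) * \<psi> (fst q) - 2 * d * (N0 + 2) \<partial>?Q)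
      \<le> - (\<integral>(t, x). smooth_neg d (v t x) * (deriv \<phi> t * 1) \<partial>QT T)"
  proof -
    have "(\<integral>q. N0 * (max 0 (- w q) * \<phi> (fst q)) + max 0 (- w q) * \<psi> (fst q) - 2 * d * (N0 + 2) \<partial>?Q)
        \<le> (\<integral>q. N0 * (smooth_neg d (w q) * \<phi> (fst q)) + smooth_neg d (w q) * \<psi> (fst q) \<partial>?Q)"
    proof (rule integral_mono_AE)
      show "AE q in ?Q. N0 * (max 0 (- w q) * \<phi> (fst q)) + max 0 (- w q) * \<psi> (fst q) - 2 * d * (N0 + 2)
          \<le> N0 * (smooth_neg d (w q) * \<phi> (fst q)) + smooth_neg d (w q) * \<psi> (fst q)"
        using AE_QT_time
      proof eventually_elim
        case (elim q)
        let ?weight = "N0 * \<phi> (fst q) + \<psi> (fst q)"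
        have weight: "0 \<le> ?weight" "?weight \<le> N0 + 2"
          using \<phi>[of "fst q"] \<psi>[of "fst q"] N0 elim mult_left_mono[OF \<phi>(2)[of "fst q"] N0] by auto
        have "max 0 (- w q) * ?weight \<le> (smooth_neg d (w q) + 2 * d) * ?weight"
          using smooth_neg_bounds(3)[OF d(1), of "w q"] weight by (intro mult_right_mono) auto
        moreover have "2 * d * ?weight \<le> 2 * d * (N0 + 2)"
          using weight d by (intro mult_left_mono) auto
        ultimately show ?case
          by (simp add: algebra_simps)
      qed
    qed (use neg_\<phi> neg_\<psi> eta_\<phi> eta_\<psi> in auto)
    also have "\<dots> = (\<integral>q. - (smooth_neg d (w q) * deriv \<phi> (fst q)) \<partial>?Q)"
      by (simp add: \<phi>_def \<psi>_def deriv_flat_exp_one algebra_simps)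
    finally show ?thesis
      by (simp add: w_def case_prod_unfold)
  qed

  have initial_zero: "(\<integral>x. smooth_neg d (x0 x) * (\<phi> 0 * 1) \<partial>torus) = 0"
  proof (rule integral_eq_zero_AE)
    show "AE x in torus. smooth_neg d (x0 x) * (\<phi> 0 * 1) = 0"
      using initial by eventually_elim (simp add: smooth_neg_nonneg_arg[OF d(1)])
  qed

  have diffusion_zero: "(\<integral>(t, x). P (v t x) * (\<phi> t * laplacian (\<lambda>_::real^'n. 1) x) \<partial>QT T) = 0"
    by (rule integral_eq_zero_AE) (simp add: laplacian_one case_prod_unfold)

  have source_bound: "(\<integral>(t, x). smooth_neg' d (v t x) * (F t x (v t x) - n t x) * (\<phi> t * 1) \<partial>QT T)
      \<le> (\<integral>q. N0 * (max 0 (- w q) * \<phi> (fst q)) \<partial>?Q)"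
  proof (rule integral_mono_AE')
    show "AE q in ?Q. (case q of (t, x) \<Rightarrow> smooth_neg' d (v t x) * (F t x (v t x) - n t x) * (\<phi> t * 1))
        \<le> N0 * (max 0 (- w q) * \<phi> (fst q))"
      using AE_QT_time reflection
    proof eventually_elim
      case (elim q)
      obtain t x where q: "q = (t, x)"
        by (cases q)
      have t: "t \<in> {0..T}" and n: "v t x < 0 \<Longrightarrow> n t x = 0"
        using elim by (auto simp: q)
      have "\<bar>F t x (v t x) - F t x 0\<bar> \<le> K * norm (x - x) powr \<kappa>' + N0 * \<bar>v t x - 0\<bar>" and "F t x 0 = 0"
        using source t unfolding source_assms_def by blast+
      then have F: "\<bar>F t x (v t x)\<bar> \<le> N0 * \<bar>v t x\<bar>"
        by simp
      have "smooth_neg' d (v t x) * (F t x (v t x) - n t x) \<le> N0 * max 0 (- v t x)"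
      proof (cases "v t x < 0")
        case True
        have "smooth_neg' d (v t x) * F t x (v t x) \<le> \<bar>smooth_neg' d (v t x)\<bar> * \<bar>F t x (v t x)\<bar>"
          by (metis abs_ge_self abs_mult)
        also have "\<dots> \<le> 1 * (N0 * \<bar>v t x\<bar>)"
          using smooth_neg'_bounds[OF d(1), of "v t x"] F by (intro mult_mono) auto
        finally show ?thesis
          using True n by simp
      next
        case False
        then show ?thesis
          using smooth_neg_nonneg_arg(2)[OF d(1), of "v t x"] N0 by simp
      qed
      from mult_right_mono[OF this \<phi>(1)[of t]] t show ?case
        by (simp add: q w_def mult.assoc)
    qed
    show "AE q in ?Q. 0 \<le> N0 * (max 0 (- w q) * \<phi> (fst q))"
      using AE_QT_time by eventually_elim (use N0 \<phi> in auto)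
  qed (use neg_\<phi> in simp)

  have ito_bound: "(\<integral>(t, x). 1/2 * smooth_neg'' d (v t x) * (\<Sum>k. (\<sigma> k (v t x))\<^sup>2) * (\<phi> t * 1)
      - smooth_neg'' d (v t x) * (norm (G t x))\<^sup>2 * (\<phi> t * 1) \<partial>QT T)
      \<le> (\<integral>q. 4 * K\<^sup>2 * (2 * d) powr (2 * \<kappa>) \<partial>?Q)"
  proof (rule integral_mono_AE')
    show "AE q in ?Q. (case q of (t, x) \<Rightarrow>
        1/2 * smooth_neg'' d (v t x) * (\<Sum>k. (\<sigma> k (v t x))\<^sup>2) * (\<phi> t * 1)
        - smooth_neg'' d (v t x) * (norm (G t x))\<^sup>2 * (\<phi> t * 1)) \<le> 4 * K\<^sup>2 * (2 * d) powr (2 * \<kappa>)"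
      using AE_QT_time
    proof eventually_elim
      case (elim q)
      obtain t x where q: "q = (t, x)"
        by (cases q)
      have t: "0 \<le> t"
        using elim by (auto simp: q)
      have "1/2 * smooth_neg'' d (v t x) * (\<Sum>k. (\<sigma> k (v t x))\<^sup>2) * \<phi> t \<le> (4 * K\<^sup>2 * (2 * d) powr (2 * \<kappa>)) * 1"
        using \<phi>[OF t] by (intro mult_mono[OF ito_correction_small[OF noise d]]) auto
      moreover have "0 \<le> smooth_neg'' d (v t x) * (norm (G t x))\<^sup>2 * \<phi> t"
        using smooth_neg''_bounds[OF d(1)] \<phi>[OF t] by simp
      ultimately show ?case
        by (simp add: q)
    qed
  qed auto

  define m where "m = measure ?Q (space ?Q)"
  have "(\<integral>q. N0 * (max 0 (- w q) * \<phi> (fst q)) + max 0 (- w q) * \<psi> (fst q) - 2 * d * (N0 + 2) \<partial>?Q)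
      \<le> (\<integral>q. N0 * (max 0 (- w q) * \<phi> (fst q)) \<partial>?Q) + (\<integral>q. 4 * K\<^sup>2 * (2 * d) powr (2 * \<kappa>) \<partial>?Q) + X"
    using lhs entropy initial_zero diffusion_zero source_bound ito_bound by linarith
  moreover have "(\<integral>q. N0 * (max 0 (- w q) * \<phi> (fst q)) + max 0 (- w q) * \<psi> (fst q) - 2 * d * (N0 + 2) \<partial>?Q)
      = (\<integral>q. N0 * (max 0 (- w q) * \<phi> (fst q)) \<partial>?Q) + (\<integral>q. max 0 (- w q) * \<psi> (fst q) \<partial>?Q) - 2 * d * (N0 + 2) * m"
    using neg_\<phi> neg_\<psi> by (simp add: m_def)
  ultimately have "(\<integral>q. max 0 (- w q) * \<psi> (fst q) \<partial>?Q) \<le> neg_part_error \<kappa> K N0 d * m + X"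
    by (simp add: neg_part_error_def m_def algebra_simps)
  then show "(\<integral>q. max 0 (- v (fst q) (snd q)) * \<psi> (fst q) \<partial>QT T)
      \<le> neg_part_error \<kappa> K N0 d * measure (QT T) (space ?Q) + X"
    by (simp add: w_def m_def)
qed

section \<open>Nonnegativity\<close>

text \<open>
  Expectations enter only here. As the Ito integral has mean zero, the pathwise bound controls
  the expected weighted negative part by an error that vanishes with \<open>d\<close>.
\<close>

lemma neg_part_vanishes_before:
  fixes u \<nu> :: "'a \<Rightarrow> real \<Rightarrow> real^'n \<Rightarrow> real" and S :: "'a \<Rightarrow> real \<Rightarrow> real"
  assumes T: "0 < T" and m: "1 < m" and \<kappa>: "0 < \<kappa>" "\<kappa> \<le> 1/2" and K: "1 \<le> K" and N0: "0 \<le> N0"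
    and filtered: "complete_filtered_prob_space M Fil"
    and wiener: "\<And>k. wiener_process M Fil T (W k)"
    and initial: "initial_assms M Fil m \<xi>"
    and noise: "noise_assms \<kappa> K \<sigma>"
    and source: "source_assms T \<kappa>' K N0 F"
    and S_cont: "\<And>\<omega>. \<omega> \<in> space M \<Longrightarrow> continuous_on {0..T} (S \<omega>)"
    and S_nonneg: "AE \<omega> in M. \<forall>t\<in>{0..T}. 0 \<le> S \<omega> t"
    and solution: "entropy_solution M Fil W T m \<Phi> \<sigma> F \<xi> S u \<nu>"
    and c: "c < T"
  shows "AE \<omega> in M. AE q in QT T. fst q < c \<longrightarrow> 0 \<le> u \<omega> (fst q) (snd q)"
proof -
  let ?Q = "QT T :: (real \<times> (real^'n)) measure"
  define V where "V = measure ?Q (space ?Q)"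
  define \<psi> where "\<psi> = flat_exp N0 c [:0, 0, 1:]"
  define Z where "Z \<omega> = (\<integral>\<^sup>+q. ennreal (max 0 (- u \<omega> (fst q) (snd q)) * \<psi> (fst q)) \<partial>?Q)" for \<omega>
  interpret prob_space M
    using filtered_prob_spaceD(1)[OF filtered] .
  interpret Q: finite_measure ?Q
    by (rule finite_measure_QT)
  have T': "0 \<le> T"
    using T by simp
  have \<psi>_measurable [measurable]: "\<psi> \<in> borel_measurable borel"
    by (simp add: \<psi>_def)
  obtain G where u: "Lp_field M Fil T (m + 1) u" and \<nu>: "Lp_field M Fil T 2 \<nu>"
    and \<nu>_nonneg: "AE \<omega> in M. AE (t, x) in ?Q. 0 \<le> \<nu> \<omega> t x"
    and entropy: "\<And>\<eta> \<phi> \<rho>. \<eta> \<in> entropies \<Longrightarrow> time_test T \<phi> \<Longrightarrow> smooth_torus \<rho> \<Longrightarrow>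
        (\<forall>t\<in>{0..<T}. \<forall>x. 0 \<le> \<phi> t * \<rho> x) \<Longrightarrow> entropy_inequality M Fil W T \<Phi> \<sigma> F \<xi> u \<nu> G \<eta> \<phi> \<rho>"
    and below: "AE \<omega> in M. AE (t, x) in ?Q. u \<omega> t x \<le> S \<omega> t"
    and contact: "AE \<omega> in M. (\<integral>(t, x). (u \<omega> t x - S \<omega> t) * \<nu> \<omega> t x \<partial>?Q) = 0"
    using solution unfolding entropy_solution_def by blast

  have joint: "(\<lambda>(\<omega>, q). u \<omega> (fst q) (snd q)) \<in> borel_measurable (M \<Otimes>\<^sub>M ?Q)"
    using predictable_field_measurable[OF filtered T'] u unfolding Lp_field_def by blast
  have "(\<lambda>(\<omega>, q). ennreal (max 0 (- u \<omega> (fst q) (snd q)) * \<psi> (fst q))) \<in> borel_measurable (M \<Otimes>\<^sub>M ?Q)"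
    using joint unfolding case_prod_beta by measurable
  then have Z_measurable: "Z \<in> borel_measurable M"
    unfolding Z_def by (rule Q.borel_measurable_nn_integral)

  have u_paths: "AE \<omega> in M. (\<lambda>q. u \<omega> (fst q) (snd q)) \<in> borel_measurable ?Q
      \<and> integrable ?Q (\<lambda>q. (u \<omega> (fst q) (snd q))\<^sup>2) \<and> integrable ?Q (\<lambda>q. u \<omega> (fst q) (snd q))"
    using Lp_field_pathwise[OF filtered T' u]
  proof eventually_elim
    case (elim \<omega>)
    then have "integrable ?Q (\<lambda>q. (u \<omega> (fst q) (snd q))\<^sup>2)"
      using Q.integrable_square_of_powr[of _ "m + 1"] m by auto
    then show ?case
      using elim Q.square_integrable_imp_integrable by blast
  qed
  have \<nu>_paths: "AE \<omega> in M. (\<lambda>q. \<nu> \<omega> (fst q) (snd q)) \<in> borel_measurable ?Q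
      \<and> integrable ?Q (\<lambda>q. (\<nu> \<omega> (fst q) (snd q))\<^sup>2)"
    using Lp_field_pathwise[OF filtered T' \<nu>]
    by eventually_elim (use Q.integrable_square_of_powr[of _ 2] in auto)
  have reflection: "AE \<omega> in M. AE q in ?Q. u \<omega> (fst q) (snd q) < 0 \<longrightarrow> \<nu> \<omega> (fst q) (snd q) = 0"
    using u_paths \<nu>_paths S_nonneg below \<nu>_nonneg contact AE_space
  proof eventually_elim
    case (elim \<omega>)
    then show ?case
      by (intro reflection_vanishes_where_negative[where s = "S \<omega>"] S_cont) (auto simp: case_prod_unfold)
  qed

  \<comment> \<open>The sum of the error and \<open>X\<close> dominates \<open>Z\<close>, so it is nonnegative almost surely and its
    integral is its mean, in which \<open>X\<close> does not appear.\<close>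
  have Z_small: "(\<integral>\<^sup>+\<omega>. Z \<omega> \<partial>M) \<le> ennreal (neg_part_error \<kappa> K N0 d * V)" if d: "0 < d" "2 * d \<le> 1" for d
  proof -
    let ?\<phi> = "flat_exp N0 c 1"
    have "entropy_inequality M Fil W T \<Phi> \<sigma> F \<xi> u \<nu> G (smooth_neg d) ?\<phi> (\<lambda>_. 1)"
      using flat_exp_one_bounds(1)[OF N0]
      by (intro entropy smooth_neg_entropy d time_test_flat_exp c smooth_torus_one) auto
    then obtain X where X: "has_ito_series M Fil W T
          (\<lambda>k \<omega> t. \<integral>x. smooth_neg' d (u \<omega> t x) * (?\<phi> t * 1) * \<sigma> k (u \<omega> t x) \<partial>torus) X"
      and ineq: "AE \<omega> in M.
            - (\<integral>(t, x). smooth_neg d (u \<omega> t x) * (deriv ?\<phi> t * 1) \<partial>?Q)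
            \<le> (\<integral>x. smooth_neg d (\<xi> \<omega> x) * (?\<phi> 0 * 1) \<partial>torus)
              + (\<integral>(t, x). primitive (\<lambda>r. (zeta \<Phi> r)\<^sup>2 * smooth_neg' d r) (u \<omega> t x)
                    * (?\<phi> t * laplacian (\<lambda>_::real^'n. 1) x) \<partial>?Q)
              + (\<integral>(t, x). smooth_neg' d (u \<omega> t x) * (F t x (u \<omega> t x) - \<nu> \<omega> t x) * (?\<phi> t * 1) \<partial>?Q)
              + (\<integral>(t, x). 1/2 * smooth_neg'' d (u \<omega> t x) * (\<Sum>k. (\<sigma> k (u \<omega> t x))\<^sup>2) * (?\<phi> t * 1)
                    - smooth_neg'' d (u \<omega> t x) * (norm (G \<omega> t x))\<^sup>2 * (?\<phi> t * 1) \<partial>?Q)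
              + X \<omega>"
      unfolding entropy_inequality_def deriv_smooth_neg deriv_smooth_neg' by blast
    note X_mean = ito_series_expectation_zero[OF filtered wiener X]
    have bound: "AE \<omega> in M. Z \<omega> \<le> ennreal (neg_part_error \<kappa> K N0 d * V + X \<omega>)
        \<and> 0 \<le> neg_part_error \<kappa> K N0 d * V + X \<omega>"
      using u_paths reflection ineq AE_space
    proof eventually_elim
      case (elim \<omega>)
      have \<xi>: "AE x in torus. 0 \<le> \<xi> \<omega> x"
        using initial elim unfolding initial_assms_def by blast
      note path = neg_part_pathwise_bound[OF N0 d noise \<kappa> K source _ elim(2) \<xi> elim(3), folded \<psi>_def V_def]
      have neg: "AE q in ?Q. 0 \<le> max 0 (- u \<omega> (fst q) (snd q)) * \<psi> (fst q)"
        using AE_QT_time by eventually_elim (use flat_exp_square_bounds(1)[OF N0] in \<open>auto simp: \<psi>_def\<close>)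
      have "Z \<omega> = ennreal (\<integral>q. max 0 (- u \<omega> (fst q) (snd q)) * \<psi> (fst q) \<partial>?Q)"
        unfolding Z_def using path(1) neg elim(1) by (intro nn_integral_eq_integral) auto
      moreover have "0 \<le> (\<integral>q. max 0 (- u \<omega> (fst q) (snd q)) * \<psi> (fst q) \<partial>?Q)"
        by (rule integral_nonneg_AE[OF neg])
      ultimately show ?case
        using path(2) elim(1) by (auto intro: ennreal_leI order_trans)
    qed
    have "(\<integral>\<^sup>+\<omega>. Z \<omega> \<partial>M) \<le> (\<integral>\<^sup>+\<omega>. ennreal (neg_part_error \<kappa> K N0 d * V + X \<omega>) \<partial>M)"
      using bound by (intro nn_integral_mono_AE) auto
    also have "\<dots> = ennreal (\<integral>\<omega>. neg_part_error \<kappa> K N0 d * V + X \<omega> \<partial>M)"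
      using bound X_mean by (intro nn_integral_eq_integral) auto
    also have "(\<integral>\<omega>. neg_part_error \<kappa> K N0 d * V + X \<omega> \<partial>M) = neg_part_error \<kappa> K N0 d * V"
      using X_mean by (simp add: prob_space)
    finally show ?thesis .
  qed
  have "((\<lambda>d. ennreal (neg_part_error \<kappa> K N0 d * V)) \<longlongrightarrow> ennreal (0 * V)) (at_right 0)"
    by (intro tendsto_intros neg_part_error_tendsto_0 \<kappa>)
  moreover have "eventually (\<lambda>d. (\<integral>\<^sup>+\<omega>. Z \<omega> \<partial>M) \<le> ennreal (neg_part_error \<kappa> K N0 d * V)) (at_right 0)"
    unfolding eventually_at_right_field by (rule exI[of _ "1/2"]) (use Z_small in auto)
  ultimately have "(\<integral>\<^sup>+\<omega>. Z \<omega> \<partial>M) \<le> ennreal (0 * V)"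
    by (rule tendsto_lowerbound) simp
  then have "AE \<omega> in M. Z \<omega> = 0"
    using nn_integral_0_iff_AE[OF Z_measurable] by simp
  then show ?thesis
    using u_paths
  proof eventually_elim
    case (elim \<omega>)
    have [measurable]: "(\<lambda>q. u \<omega> (fst q) (snd q)) \<in> borel_measurable ?Q"
      using elim by blast
    have "(\<lambda>q. ennreal (max 0 (- u \<omega> (fst q) (snd q)) * \<psi> (fst q))) \<in> borel_measurable ?Q"
      by measurable
    from nn_integral_0_iff_AE[OF this]
    have "AE q in ?Q. max 0 (- u \<omega> (fst q) (snd q)) * \<psi> (fst q) \<le> 0"
      using elim(1) by (simp add: Z_def ennreal_eq_0_iff)
    then show ?case
    proof eventually_elim
      case (elim q)
      show ?case
      proof
        assume "fst q < c"
        then have "0 < \<psi> (fst q)"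
          by (simp add: \<psi>_def flat_exp_square_pos)
        then have "max 0 (- u \<omega> (fst q) (snd q)) \<le> 0"
          using elim by (simp add: mult_le_0_iff)
        then show "0 \<le> u \<omega> (fst q) (snd q)"
          by simp
      qed
    qed
  qed
qed

theorem proposition2p13:
  fixes M :: "'a measure" and Fil :: "real \<Rightarrow> 'a measure" and W :: "nat \<Rightarrow> 'a \<Rightarrow> real \<Rightarrow> real"
    and T m \<kappa> \<kappa>' K N0 :: real
    and \<Phi> :: "real \<Rightarrow> real" and \<sigma> :: "nat \<Rightarrow> real \<Rightarrow> real" and F :: "real \<Rightarrow> real^'n \<Rightarrow> real \<Rightarrow> real"
    and \<xi> :: "'a \<Rightarrow> real^'n \<Rightarrow> real" and h S :: "'a \<Rightarrow> real \<Rightarrow> real"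
    and u \<nu> :: "'a \<Rightarrow> real \<Rightarrow> real^'n \<Rightarrow> real"
  assumes "T > 0" and "m > 1" and "0 < \<kappa>" "\<kappa> \<le> 1/2" and "0 < \<kappa>'" "\<kappa>' < 1" and "K \<ge> 1" and "N0 \<ge> 0"
    and "complete_filtered_prob_space M Fil"
    and "independent_wiener_processes M Fil T W"
    and "diffusion_assms m K \<Phi>"
    and "initial_assms M Fil m \<xi>"
    and "noise_assms \<kappa> K \<sigma>"
    and "source_assms T \<kappa>' K N0 F"
    and "obstacle_assms M Fil W T \<sigma> \<xi> h S"
    and "entropy_solution M Fil W T m \<Phi> \<sigma> F \<xi> S u \<nu>"
  shows "AE \<omega> in M. AE (t, x) in QT T. u \<omega> t x \<ge> 0"
proof -
  have wiener: "wiener_process M Fil T (W k)" for k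
    using assms(10) unfolding independent_wiener_processes_def by blast
  have S_cont: "continuous_on {0..T} (S \<omega>)" if "\<omega> \<in> space M" for \<omega>
    using assms(15) that unfolding obstacle_assms_def by blast
  have S_nonneg: "AE \<omega> in M. \<forall>t\<in>{0..T}. 0 \<le> S \<omega> t"
    using assms(15) unfolding obstacle_assms_def by blast
  \<comment> \<open>Countably many cutoff times exhaust all times before \<open>T\<close>, and the slice at \<open>T\<close> is null.\<close>
  have "AE \<omega> in M. AE q in QT T. fst q < T - 1 / real (Suc n) \<longrightarrow> 0 \<le> u \<omega> (fst q) (snd q)" for n
    by (rule neg_part_vanishes_before[OF assms(1-4,7-9) wiener assms(12-14) S_cont S_nonneg assms(16)]) simp_all
  then have "AE \<omega> in M. \<forall>n. AE q in QT T. fst q < T - 1 / real (Suc n) \<longrightarrow> 0 \<le> u \<omega> (fst q) (snd q)"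
    by (simp add: AE_all_countable)
  then show ?thesis
  proof eventually_elim
    case (elim \<omega>)
    then have "AE q in QT T. \<forall>n. fst q < T - 1 / real (Suc n) \<longrightarrow> 0 \<le> u \<omega> (fst q) (snd q)"
      by (subst AE_all_countable)
    then have "AE q in QT T. 0 \<le> u \<omega> (fst q) (snd q)"
      using AE_QT_time AE_QT_before_end
    proof eventually_elim
      case (elim q)
      then have "0 < T - fst q"
        by simp
      then obtain n where "1 / real (Suc n) < T - fst q"
        using nat_approx_posE by blast
      then have "fst q < T - 1 / real (Suc n)"
        by linarith
      then show ?case
        using elim(1) by blast
    qed
    then show ?case
      by (simp add: case_prod_unfold)
  qed
qed

end
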